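(* Let $w=\varepsilon_1\ldots\varepsilon_k$ be a non-empty admissible binary word. For all integers $m\ge0$, $n\ge0$ and $N\ge1$, $$\begin{aligned}\zeta(w)_{m,n}={}&\sum_{s\in S}\zeta_{]m,m+N]}(\mathbf b_s)\,\zeta_{]n,n+N]}(\mathbf a_s)\,\zeta(w_s)_{m+N,n+N}\\ &+\sum_{M=1}^{N}\sum_{s\in S_0}\zeta_{]m,m+M-1]}(\mathbf b_s)\,\varphi_{n,n+M}(\mathbf a_s)\,\zeta(0)_{m+M,n+M}\\ &+\sum_{M=1}^{N}\sum_{s\in S_1}\varphi_{m,m+M}(\mathbf b_s)\,\zeta_{]n,n+M-1]}(\mathbf a_s)\,\zeta(1)_{m+M,n+M}\\ &+\sum_{M=1}^{N}\sum_{s\in S_\varnothing}\varphi_{m,m+M}(\mathbf b_s)\,\varphi_{n,n+M}(\mathbf a_s)\,\zeta(\varnothing)_{m+M,n+M}.\end{aligned}$$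
   Context: A binary word is a finite word over $\{0,1\}$ (possibly empty, $\varnothing$); it is admissible if empty or it starts with $0$ and ends with $1$. A composition is a finite sequence of positive integers; its binary word is $\mathbf w(a_1,\ldots,a_r)=\{0\}_{a_1-1}1\cdots\{0\}_{a_r-1}1$ ($\{0\}_u$ = $u$ letters $0$), a bijection onto binary words that are empty or end with $1$. $\overline0=1,\overline1=0$. Set $f_0(t)=1/t$, $f_1(t)=1/(1-t)$. For a binary word $u=\eta_1\ldots\eta_\ell$ and $p,q\ge0$ integers with $p\ge1$ if $u$ starts with $1$ and $q\ge1$ if $u$ ends with $0$: for $\ell\ge1$, $\zeta(u)_{p,q}=\int_{1>t_1>\cdots>t_\ell>0}(1-t_1)^p f_{\eta_1}(t_1)\cdots f_{\eta_\ell}(t_\ell)t_\ell^q\,dt_1\cdots dt_\ell$ (so $\zeta(0)_{p,q}=\frac{p!(q-1)!}{(p+q)!}$, $\zeta(1)_{p,q}=\frac{(p-1)!q!}{(p+q)!}$), and $\zeta(\varnothing)_{p,q}=\frac{p!q!}{(p+q)!}$. For a non-empty composition $\mathbf c=(c_1,\ldots,c_r)$ and integers $0\le p<q$: $\varphi_{p,q}(\mathbf c)=q^{-c_1}\sum_{q>n_2>\cdots>n_r>p}n_2^{-c_2}\cdots n_r^{-c_r}$ (equal to $q^{-c_1}$ if $r=1$). For any composition $\mathbf c$ and $0\le p\le q$: $\zeta_{]p,q]}(\mathbf c)=\sum_{q\ge n_1>\cdots>n_r>p}n_1^{-c_1}\cdots n_r^{-c_r}$ (equal to $1$ if $\mathbf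 c$ is empty). For a pair $s=(i,j)$ of integers with $0\le i\le j\le k$: $w_s=\varepsilon_{i+1}\ldots\varepsilon_j$; $\mathbf a_s$ is the composition with binary word $\varepsilon_{j+1}\ldots\varepsilon_k$; $\mathbf b_s$ is the composition with binary word $\overline{\varepsilon_i}\ldots\overline{\varepsilon_1}$ (the dual of $\varepsilon_1\ldots\varepsilon_i$). $S$ (resp. $S_0$, $S_1$) is the set of such pairs $s$ for which $w_s$ is non-empty, starts with $0$ and ends with $1$ (resp. $w_s=0$, resp. $w_s=1$), and $S_\varnothing=\{(i,i):0<i<k\}$. *)

theory Defs
  imports "HOL-Analysis.Analysis"
begin

text \<open>The letters 0 and 1 are encoded as \<^const>\<open>False\<close> and \<^const>\<open>True\<close>, so that the bar
  operation is negation.\<close>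

type_synonym bword = "bool list"

definition admissible :: "bword \<Rightarrow> bool" where
  "admissible u \<longleftrightarrow> u = [] \<or> (hd u = False \<and> last u = True)"

definition composition :: "nat list \<Rightarrow> bool" where
  "composition c \<longleftrightarrow> (\<forall>a\<in>set c. 1 \<le> a)"

definition comp_word :: "nat list \<Rightarrow> bword" where
  "comp_word c = concat (map (\<lambda>a. replicate (a - 1) False @ [True]) c)"

definition comp_of_word :: "bword \<Rightarrow> nat list" where
  "comp_of_word u = (THE c. composition c \<and> comp_word c = u)"

lemma comp_word_simps [simp]:
  "comp_word [] = []"
  "comp_word (a # c) = replicate (a - 1) False @ True # comp_word c"
  by (simp_all add: comp_word_def)

lemma replicate_False_True_inject:
  "replicate a False @ True # u = replicate b False @ True # v \<longleftrightarrow> a = b \<and> u = v"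
proof (induction a arbitrary: b)
  case 0
  show ?case by (cases b) auto
next
  case (Suc a)
  then show ?case by (cases b) auto
qed

lemma comp_word_inj: "inj_on comp_word {c. composition c}"
proof (rule inj_onI)
  fix c d assume "c \<in> {c. composition c}" "d \<in> {c. composition c}" "comp_word c = comp_word d"
  then show "c = d"
  proof (induction c arbitrary: d)
    case Nil
    then show ?case by (cases d) auto
  next
    case (Cons a c)
    then obtain b d' where d: "d = b # d'" by (cases d) auto
    have "a - 1 = b - 1" "comp_word c = comp_word d'"
      using Cons.prems(3) by (simp_all add: d replicate_False_True_inject)
    moreover have "1 \<le> a" "1 \<le> b" "composition c" "composition d'"
      using Cons.prems(1,2) by (auto simp: d composition_def)
    ultimately show ?case using Cons.IH[of d'] d by simp
  qed
qed

lemma comp_word_surj: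
  assumes "u = [] \<or> last u = True"
  shows "\<exists>c. composition c \<and> comp_word c = u"
  using assms
proof (induction u)
  case Nil
  show ?case by (rule exI[of _ "[]"]) (simp add: composition_def)
next
  case (Cons x u)
  then obtain c where c: "composition c" "comp_word c = u"
    by (cases u) auto
  show ?case
  proof (cases x)
    case True
    then show ?thesis
      using c by (intro exI[of _ "1 # c"]) (simp add: composition_def)
  next
    case False
    then have "u \<noteq> []" using Cons.prems by auto
    then obtain a d where d: "c = a # d" using c by (cases c) auto
    have "1 \<le> a" using c by (simp add: d composition_def)
    then have "replicate a False = False # replicate (a - 1) False"
      by (cases a) auto
    then show ?thesis
      using c False by (intro exI[of _ "Suc a # d"]) (auto simp: composition_def d)
  qed
qed

lemma comp_of_word:
  assumes "u = [] \<or> last u = True"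
  shows "composition (comp_of_word u)" and "comp_word (comp_of_word u) = u"
proof -
  have "\<exists>!c. composition c \<and> comp_word c = u"
    using comp_word_surj[OF assms] comp_word_inj by (auto simp: inj_on_def)
  from theI'[OF this] show "composition (comp_of_word u)" "comp_word (comp_of_word u) = u"
    by (simp_all add: comp_of_word_def)
qed

definition letter_fun :: "bool \<Rightarrow> real \<Rightarrow> real" where
  "letter_fun e t = (if e then 1 / (1 - t) else 1 / t)"

text \<open>Points of \<open>\<real>\<^sup>l\<close> are the extensional functions on \<open>{..<l}\<close>; the coordinates are numbered from 0,
  so \<open>t 0\<close> is the largest one.\<close>

definition open_simplex :: "nat \<Rightarrow> (nat \<Rightarrow> real) set" where
  "open_simplex l =
     {t \<in> {..<l} \<rightarrow>\<^sub>E UNIV. 1 > t 0 \<and> (\<forall>i. Suc i < l \<longrightarrow> t i > t (Suc i)) \<and> t (l - 1) > 0}"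

text \<open>The integral converges only if \<open>p \<ge> 1\<close> or \<open>u\<close> does not start with 1, and \<open>q \<ge> 1\<close> or \<open>u\<close> does
  not end with 0; other values of \<open>zeta_int\<close> are meaningless.\<close>

definition zeta_int :: "bword \<Rightarrow> nat \<Rightarrow> nat \<Rightarrow> real" where
  "zeta_int u p q =
     (if u = [] then fact p * fact q / fact (p + q)
      else (LINT t:open_simplex (length u)|PiM {..<length u} (\<lambda>_. lborel).
              (1 - t 0) ^ p * (\<Prod>i<length u. letter_fun (u ! i) (t i)) * t (length u - 1) ^ q))"

definition decr_seqs :: "nat \<Rightarrow> nat set \<Rightarrow> nat list set" where
  "decr_seqs r A = {ns. length ns = r \<and> sorted_wrt (>) ns \<and> set ns \<subseteq> A}"

definition zeta_trunc :: "nat \<Rightarrow> nat \<Rightarrow> nat list \<Rightarrow> real" where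
  "zeta_trunc p q c =
     (\<Sum>ns\<in>decr_seqs (length c) {p<..q}. \<Prod>i<length c. 1 / real (ns ! i) ^ (c ! i))"

text \<open>Only meaningful for non-empty \<open>c\<close> and \<open>p < q\<close>; here \<open>ns\<close> is \<open>(n\<^sub>2, \<dots>, n\<^sub>r)\<close>.\<close>

definition phi :: "nat \<Rightarrow> nat \<Rightarrow> nat list \<Rightarrow> real" where
  "phi p q c =
     1 / real q ^ hd c *
     (\<Sum>ns\<in>decr_seqs (length c - 1) {p<..<q}. \<Prod>i<length c - 1. 1 / real (ns ! i) ^ (c ! Suc i))"

definition mid_word :: "bword \<Rightarrow> nat \<times> nat \<Rightarrow> bword" where
  "mid_word w s = take (snd s - fst s) (drop (fst s) w)"

definition comp_a :: "bword \<Rightarrow> nat \<times> nat \<Rightarrow> nat list" where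
  "comp_a w s = comp_of_word (drop (snd s) w)"

definition comp_b :: "bword \<Rightarrow> nat \<times> nat \<Rightarrow> nat list" where
  "comp_b w s = comp_of_word (map Not (rev (take (fst s) w)))"

definition pairs :: "bword \<Rightarrow> (nat \<times> nat) set" where
  "pairs w = {(i, j). i \<le> j \<and> j \<le> length w}"

definition S_adm :: "bword \<Rightarrow> (nat \<times> nat) set" where
  "S_adm w = {s \<in> pairs w. mid_word w s \<noteq> [] \<and> hd (mid_word w s) = False \<and> last (mid_word w s) = True}"

definition S_zero :: "bword \<Rightarrow> (nat \<times> nat) set" where
  "S_zero w = {s \<in> pairs w. mid_word w s = [False]}"

definition S_one :: "bword \<Rightarrow> (nat \<times> nat) set" where
  "S_one w = {s \<in> pairs w. mid_word w s = [True]}"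

definition S_empty :: "bword \<Rightarrow> (nat \<times> nat) set" where
  "S_empty w = {(i, i) | i. 0 < i \<and> i < length w}"

end

theory Submission
  imports Defs
begin

text \<open>Expanding one letter at each end of \<open>u = 0v1\<close> with \<open>1/t = (1 - t)/t + 1\<close> and
  \<open>1/(1 - t) = t/(1 - t) + 1\<close>, and integrating out an outermost letter 1 or an innermost letter 0, gives
  \<open>\<zeta>(0v1)\<^bsub>p-1,q-1\<^esub> = \<zeta>(0v1)\<^bsub>p,q\<^esub> + \<zeta>(0v)\<^bsub>p,q\<^esub>/q + \<zeta>(v1)\<^bsub>p,q\<^esub>/p + \<zeta>(v)\<^bsub>p,q\<^esub>/(pq)\<close>,
  together with \<open>\<zeta>(1v)\<^bsub>p,q\<^esub> = \<zeta>(v)\<^bsub>p,q\<^esub>/p\<close> and \<open>\<zeta>(v0)\<^bsub>p,q\<^esub> = \<zeta>(v)\<^bsub>p,q\<^esub>/q\<close>. Let \<open>F M\<close> be the first sum of the theorem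
  with \<open>N\<close> replaced by \<open>M\<close>. Then \<open>F 0 = \<zeta>(w)\<^bsub>m,n\<^esub>\<close>, and inserting the relation for every factor
  \<open>\<zeta>(w\<^sub>s)\<close> makes \<open>F (M - 1) - F M\<close> telescope along both ends of \<open>w\<^sub>s\<close>; the boundary terms are the
  \<open>M\<close>-th summands of the other three sums. The integrals are handled with values in the extended
  nonnegative reals, where these relations need no integrability; finiteness then descends through the same
  relation from large \<open>p\<close> and \<open>q\<close>, where the integrand is at most 1.\<close>

section \<open>Iterated integrals\<close>

lemma letter_fun_nonneg: "0 < t \<Longrightarrow> t < 1 \<Longrightarrow> 0 \<le> letter_fun e t"
  by (simp add: letter_fun_def)

lemma borel_measurable_letter_fun [measurable]: "letter_fun e \<in> borel_measurable borel"
  unfolding letter_fun_def by measurable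

text \<open>In \<open>upper_int\<close> and \<open>zeta_nn\<close> the word is read backwards: the head of the list is the letter of the
  smallest variable. So \<open>upper_int p r y\<close> is the integral over \<open>1 > t\<^sub>1 > \<dots> > t\<^sub>l > y\<close>.\<close>

primrec upper_int :: "nat \<Rightarrow> bool list \<Rightarrow> real \<Rightarrow> ennreal" where
  "upper_int p [] y = ennreal ((1 - y) ^ p)"
| "upper_int p (e # r) y =
     (\<integral>\<^sup>+s. indicator {y<..<1} s * (ennreal (letter_fun e s) * upper_int p r s) \<partial>lborel)"

primrec zeta_nn :: "nat \<Rightarrow> nat \<Rightarrow> bool list \<Rightarrow> ennreal" where
  "zeta_nn p q [] = ennreal (fact p * fact q / fact (p + q))"
| "zeta_nn p q (e # r) =
     (\<integral>\<^sup>+s. indicator {0<..<1} s * (ennreal (s ^ q) * ennreal (letter_fun e s) * upper_int p r s) \<partial>lborel)"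

lemma borel_measurable_upper_int [measurable]: "upper_int p r \<in> borel_measurable borel"
proof (induction r)
  case Nil
  show ?case by simp
next
  case (Cons e r)
  note [measurable] = Cons
  \<comment> \<open>The indicator depends on \<open>y\<close> through its set; as a condition on the
    pair of \<open>y\<close> and \<open>s\<close> it becomes visibly jointly measurable.\<close>
  have "(\<lambda>y. \<integral>\<^sup>+s. (if y < s \<and> s < 1 then 1 else 0) *
      (ennreal (letter_fun e s) * upper_int p r s) \<partial>lborel) \<in> borel_measurable borel"
    by measurable
  also have "(\<lambda>y. \<integral>\<^sup>+s. (if y < s \<and> s < 1 then 1 else 0) *
      (ennreal (letter_fun e s) * upper_int p r s) \<partial>lborel) = upper_int p (e # r)"
    by (intro ext) (auto intro!: nn_integral_cong simp: indicator_def)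
  finally show ?case .
qed

section \<open>One-variable integrals with explicit values\<close>

lemma nn_integral_Ioo_eq_Icc:
  fixes F :: "real \<Rightarrow> ennreal"
  shows "(\<integral>\<^sup>+s. indicator {a<..<b} s * F s \<partial>lborel) = (\<integral>\<^sup>+s. indicator {a..b} s * F s \<partial>lborel)"
proof (rule nn_integral_cong_AE)
  show "AE s in lborel. indicator {a<..<b} s * F s = indicator {a..b} s * F s"
    using AE_lborel_singleton[of a] AE_lborel_singleton[of b]
    by eventually_elim (auto simp: indicator_def)
qed

lemma nn_integral_power_Ioo:
  assumes "0 \<le> r"
  shows "(\<integral>\<^sup>+s. indicator {0<..<r} s * ennreal (s ^ q) \<partial>lborel) = ennreal (r ^ Suc q / real (Suc q))"
proof -
  have "(\<integral>\<^sup>+s. ennreal (s ^ q) * indicator {0..r} s \<partial>lborel)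
      = ennreal (r ^ Suc q / real (Suc q) - 0 ^ Suc q / real (Suc q))"
    using assms
    by (intro nn_integral_FTC_Icc[where F = "\<lambda>s. s ^ Suc q / real (Suc q)"])
       (auto intro!: derivative_eq_intros simp del: power_Suc of_nat_Suc)
  then show ?thesis
    unfolding nn_integral_Ioo_eq_Icc by (simp add: mult.commute)
qed

lemma nn_integral_one_minus_power_Ioo:
  assumes "y \<le> 1"
  shows "(\<integral>\<^sup>+s. indicator {y<..<1} s * ennreal ((1 - s) ^ p) \<partial>lborel)
    = ennreal ((1 - y) ^ Suc p / real (Suc p))"
proof -
  have "(\<integral>\<^sup>+s. ennreal ((1 - s) ^ p) * indicator {y..1} s \<partial>lborel)
      = ennreal (- ((1 - 1) ^ Suc p / real (Suc p)) - - ((1 - y) ^ Suc p / real (Suc p)))"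
    using assms
    by (intro nn_integral_FTC_Icc[where F = "\<lambda>s. - ((1 - s) ^ Suc p / real (Suc p))"])
       (auto intro!: derivative_eq_intros simp del: power_Suc of_nat_Suc)
  then show ?thesis
    unfolding nn_integral_Ioo_eq_Icc by (simp add: mult.commute)
qed

text \<open>This is the Beta integral B(q+1, p+1). It treats one-letter words, where the value
  assigned to the empty word has to come out of an actual integral.\<close>

lemma nn_integral_Beta_nat:
  "(\<integral>\<^sup>+s. indicator {0<..<1} s * ennreal (s ^ q * (1 - s) ^ p) \<partial>lborel)
    = ennreal (fact p * fact q / fact (Suc (p + q)))"
proof -
  have "((\<lambda>t. t powr (real (Suc q) - 1) * (1 - t) powr (real (Suc p) - 1)) has_integral
      Beta (real (Suc q)) (real (Suc p))) {0..1}"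
    by (rule has_integral_Beta_real) auto
  from nn_integral_has_integral_lebesgue[OF _ this]
  have "(\<integral>\<^sup>+t. ennreal (indicator {0..1} t * (t powr (real (Suc q) - 1) * (1 - t) powr (real (Suc p) - 1))) \<partial>lborel)
      = ennreal (Beta (real (Suc q)) (real (Suc p)))"
    by simp
  also have "Beta (real (Suc q)) (real (Suc p)) = fact p * fact q / fact (Suc (p + q))"
    using Gamma_fact[of p, where 'a = real] Gamma_fact[of q, where 'a = real]
      Gamma_fact[of "Suc (p + q)", where 'a = real]
    by (simp add: Beta_def add_ac)
  also have "(\<integral>\<^sup>+t. ennreal (indicator {0..1} t * (t powr (real (Suc q) - 1) * (1 - t) powr (real (Suc p) - 1))) \<partial>lborel)
      = (\<integral>\<^sup>+t. indicator {0..1} t * ennreal (t powr (real (Suc q) - 1) * (1 - t) powr (real (Suc p) - 1)) \<partial>lborel)"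
    by (auto intro!: nn_integral_cong simp: indicator_def)
  also have "\<dots> = (\<integral>\<^sup>+t. indicator {0<..<1} t * ennreal (t powr (real (Suc q) - 1) * (1 - t) powr (real (Suc p) - 1)) \<partial>lborel)"
    by (rule nn_integral_Ioo_eq_Icc[symmetric])
  also have "\<dots> = (\<integral>\<^sup>+s. indicator {0<..<1} s * ennreal (s ^ q * (1 - s) ^ p) \<partial>lborel)"
    by (auto intro!: nn_integral_cong simp: indicator_def powr_realpow)
  finally show ?thesis .
qed

section \<open>Relations for the letters at the two ends of a word\<close>

text \<open>The last list entry belongs to the largest variable, which the recursion integrates
  first. Its factor 1/(1 - s) cancels one power of 1 - s, and the constant left by the integration
  passes out through all other integrals.\<close>

lemma upper_int_snoc_True:
  assumes "y < 1"
  shows "upper_int (Suc p) (r @ [True]) y = ennreal (1 / real (Suc p)) * upper_int (Suc p) r y"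
  using assms
proof (induction r arbitrary: y)
  case Nil
  have "upper_int (Suc p) ([] @ [True]) y = (\<integral>\<^sup>+s. indicator {y<..<1} s * ennreal ((1 - s) ^ p) \<partial>lborel)"
    by (auto intro!: nn_integral_cong simp: indicator_def letter_fun_def ennreal_mult'[symmetric])
  also have "\<dots> = ennreal ((1 - y) ^ Suc p / real (Suc p))"
    using Nil by (intro nn_integral_one_minus_power_Ioo) auto
  also have "\<dots> = ennreal (1 / real (Suc p)) * upper_int (Suc p) [] y"
    using Nil by (simp add: ennreal_mult'[symmetric] del: of_nat_Suc)
  finally show ?case .
next
  case (Cons e r)
  have "upper_int (Suc p) ((e # r) @ [True]) y = (\<integral>\<^sup>+s. ennreal (1 / real (Suc p)) *
      (indicator {y<..<1} s * (ennreal (letter_fun e s) * upper_int (Suc p) r s)) \<partial>lborel)"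
    using Cons.IH by (auto intro!: nn_integral_cong simp: indicator_def mult_ac simp del: of_nat_Suc)
  also have "\<dots> = ennreal (1 / real (Suc p)) * upper_int (Suc p) (e # r) y"
    by (subst nn_integral_cmult) auto
  finally show ?case .
qed

text \<open>For the largest variable, 1/s = (1 - s)/s + (1 - s)/(1 - s): both summands gain a power
  of 1 - s, and the second carries the letter 1.\<close>

lemma upper_int_snoc_False:
  assumes "0 \<le> y"
  shows "upper_int p (r @ [False]) y = upper_int (Suc p) (r @ [False]) y + upper_int (Suc p) (r @ [True]) y"
  using assms
proof (induction r arbitrary: y)
  case Nil
  have "upper_int p ([] @ [False]) y = (\<integral>\<^sup>+s.
      indicator {y<..<1} s * (ennreal (letter_fun False s) * upper_int (Suc p) [] s)
    + indicator {y<..<1} s * (ennreal (letter_fun True s) * upper_int (Suc p) [] s) \<partial>lborel)"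
    using Nil by (auto intro!: nn_integral_cong simp: indicator_def letter_fun_def
      ennreal_mult'[symmetric] ennreal_plus[symmetric] field_simps simp del: ennreal_plus)
  also have "\<dots> = upper_int (Suc p) ([] @ [False]) y + upper_int (Suc p) ([] @ [True]) y"
    by (subst nn_integral_add) auto
  finally show ?case .
next
  case (Cons e r)
  have "upper_int p ((e # r) @ [False]) y = (\<integral>\<^sup>+s.
      indicator {y<..<1} s * (ennreal (letter_fun e s) * upper_int (Suc p) (r @ [False]) s)
    + indicator {y<..<1} s * (ennreal (letter_fun e s) * upper_int (Suc p) (r @ [True]) s) \<partial>lborel)"
    using Cons by (auto intro!: nn_integral_cong simp: indicator_def distrib_left)
  also have "\<dots> = upper_int (Suc p) ((e # r) @ [False]) y + upper_int (Suc p) ((e # r) @ [True]) y"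
    by (subst nn_integral_add) auto
  finally show ?case .
qed

text \<open>Transfers \<open>upper_int_snoc_True\<close> to the full integral. One-letter words are
  separate because the empty word has an assigned value and no integral.\<close>

lemma zeta_nn_snoc_True:
  "zeta_nn (Suc p) q (r @ [True]) = ennreal (1 / real (Suc p)) * zeta_nn (Suc p) q r"
proof (cases r)
  case Nil
  have "zeta_nn (Suc p) q ([] @ [True])
      = (\<integral>\<^sup>+s. indicator {0<..<1} s * ennreal (s ^ q * (1 - s) ^ p) \<partial>lborel)"
    by (auto intro!: nn_integral_cong simp: indicator_def letter_fun_def ennreal_mult'[symmetric])
  also have "\<dots> = ennreal (fact p * fact q / fact (Suc (p + q)))"
    by (rule nn_integral_Beta_nat)
  also have "\<dots> = ennreal (1 / real (Suc p)) * zeta_nn (Suc p) q []"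
    by (simp add: ennreal_mult'[symmetric])
  finally show ?thesis using Nil by simp
next
  case (Cons e v)
  have "zeta_nn (Suc p) q (r @ [True]) = (\<integral>\<^sup>+s. ennreal (1 / real (Suc p)) * (indicator {0<..<1} s *
      (ennreal (s ^ q) * ennreal (letter_fun e s) * upper_int (Suc p) v s)) \<partial>lborel)"
    by (auto intro!: nn_integral_cong simp: Cons indicator_def mult_ac upper_int_snoc_True simp del: of_nat_Suc)
  also have "\<dots> = ennreal (1 / real (Suc p)) * zeta_nn (Suc p) q r"
    unfolding Cons by (subst nn_integral_cmult) auto
  finally show ?thesis .
qed

lemma zeta_nn_snoc_False:
  "zeta_nn p q (r @ [False]) = zeta_nn (Suc p) q (r @ [False]) + zeta_nn (Suc p) q (r @ [True])"
proof (cases r)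
  case Nil
  have "zeta_nn p q ([] @ [False]) = (\<integral>\<^sup>+s.
      indicator {0<..<1} s * (ennreal (s ^ q) * ennreal (letter_fun False s) * upper_int (Suc p) [] s)
    + indicator {0<..<1} s * (ennreal (s ^ q) * ennreal (letter_fun True s) * upper_int (Suc p) [] s) \<partial>lborel)"
    by (auto intro!: nn_integral_cong simp: indicator_def letter_fun_def
      ennreal_mult'[symmetric] ennreal_plus[symmetric] field_simps simp del: ennreal_plus)
  also have "\<dots> = zeta_nn (Suc p) q ([] @ [False]) + zeta_nn (Suc p) q ([] @ [True])"
    by (subst nn_integral_add) auto
  finally show ?thesis using Nil by simp
next
  case (Cons e v)
  have "zeta_nn p q (r @ [False]) = (\<integral>\<^sup>+s.
      indicator {0<..<1} s * (ennreal (s ^ q) * ennreal (letter_fun e s) * upper_int (Suc p) (v @ [False]) s)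
    + indicator {0<..<1} s * (ennreal (s ^ q) * ennreal (letter_fun e s) * upper_int (Suc p) (v @ [True]) s) \<partial>lborel)"
    by (auto intro!: nn_integral_cong simp: Cons indicator_def distrib_left upper_int_snoc_False[of _ p])
  also have "\<dots> = zeta_nn (Suc p) q (r @ [False]) + zeta_nn (Suc p) q (r @ [True])"
    unfolding Cons by (subst nn_integral_add) auto
  finally show ?thesis .
qed

text \<open>For the smallest variable, 1/(1 - s) = s/(1 - s) + s/s: both summands gain a power of s,
  and the second carries the letter 0.\<close>

lemma zeta_nn_Cons_True:
  "zeta_nn p q (True # r) = zeta_nn p (Suc q) (True # r) + zeta_nn p (Suc q) (False # r)"
proof -
  have eq: "ennreal (s ^ q) * ennreal (letter_fun True s) =
      ennreal (s ^ Suc q) * ennreal (letter_fun True s) + ennreal (s ^ Suc q) * ennreal (letter_fun False s)"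
    if "0 < s" "s < 1" for s :: real
    using that by (auto simp: letter_fun_def ennreal_mult'[symmetric] ennreal_plus[symmetric] field_simps
        simp del: ennreal_plus)
  have "zeta_nn p q (True # r) = (\<integral>\<^sup>+s.
      indicator {0<..<1} s * (ennreal (s ^ Suc q) * ennreal (letter_fun True s) * upper_int p r s)
    + indicator {0<..<1} s * (ennreal (s ^ Suc q) * ennreal (letter_fun False s) * upper_int p r s) \<partial>lborel)"
    by (auto intro!: nn_integral_cong simp: indicator_def eq distrib_right simp del: power_Suc)
  also have "\<dots> = zeta_nn p (Suc q) (True # r) + zeta_nn p (Suc q) (False # r)"
    by (subst nn_integral_add) auto
  finally show ?thesis .
qed

text \<open>The smallest variable enters only through s^(q+1)/s = s^q, and integrating this from 0
  to the next variable t yields t^(q+1)/(q+1). The recursion integrates the smallest variable last,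
  so the order of the two outer integrals is exchanged first.\<close>

lemma zeta_nn_Cons_False:
  "zeta_nn p (Suc q) (False # r) = ennreal (1 / real (Suc q)) * zeta_nn p (Suc q) r"
proof (cases r)
  case Nil
  have "zeta_nn p (Suc q) [False]
      = (\<integral>\<^sup>+s. indicator {0<..<1} s * ennreal (s ^ q * (1 - s) ^ p) \<partial>lborel)"
    by (auto intro!: nn_integral_cong simp: indicator_def letter_fun_def ennreal_mult'[symmetric])
  also have "\<dots> = ennreal (fact p * fact q / fact (Suc (p + q)))"
    by (rule nn_integral_Beta_nat)
  also have "\<dots> = ennreal (1 / real (Suc q)) * zeta_nn p (Suc q) []"
    by (simp add: ennreal_mult'[symmetric])
  finally show ?thesis using Nil by simp
next
  case (Cons e v)
  define h where "h s = ennreal (letter_fun e s) * upper_int p v s" for s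
  have [measurable]: "h \<in> borel_measurable borel" unfolding h_def by measurable
  have "zeta_nn p (Suc q) (False # r) = (\<integral>\<^sup>+s. indicator {0<..<1} s * ennreal (s ^ q) *
      (\<integral>\<^sup>+t. indicator {s<..<1} t * h t \<partial>lborel) \<partial>lborel)"
    unfolding Cons by (auto intro!: nn_integral_cong
      simp: indicator_def letter_fun_def ennreal_mult'[symmetric] h_def)
  also have "\<dots> = (\<integral>\<^sup>+s. \<integral>\<^sup>+t. indicator {0<..<1} s * ennreal (s ^ q) *
      (indicator {s<..<1} t * h t) \<partial>lborel \<partial>lborel)"
    by (intro nn_integral_cong nn_integral_cmult[symmetric]) auto
  \<comment> \<open>Both indicators merge into one condition on \<open>s\<close> and
    \<open>t\<close>, which gives the joint measurability for Tonelli's theorem and allows reading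
    the range of \<open>s\<close> for fixed \<open>t\<close>.\<close>
  also have "\<dots> = (\<integral>\<^sup>+s. \<integral>\<^sup>+t. (if 0 < s \<and> s < t \<and> t < 1 then 1 else 0) * ennreal (s ^ q) * h t
      \<partial>lborel \<partial>lborel)"
    by (intro nn_integral_cong) (auto simp: indicator_def)
  also have "\<dots> = (\<integral>\<^sup>+t. \<integral>\<^sup>+s. (if 0 < s \<and> s < t \<and> t < 1 then 1 else 0) * ennreal (s ^ q) * h t
      \<partial>lborel \<partial>lborel)"
    by (rule lborel_pair.Fubini') measurable
  also have "\<dots> = (\<integral>\<^sup>+t. \<integral>\<^sup>+s. (indicator {0<..<1} t * h t) * (indicator {0<..<t} s * ennreal (s ^ q))
      \<partial>lborel \<partial>lborel)"
    by (intro nn_integral_cong) (auto simp: indicator_def mult_ac)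
  also have "\<dots> = (\<integral>\<^sup>+t. (indicator {0<..<1} t * h t) *
      (\<integral>\<^sup>+s. indicator {0<..<t} s * ennreal (s ^ q) \<partial>lborel) \<partial>lborel)"
    by (intro nn_integral_cong nn_integral_cmult) auto
  also have "\<dots> = (\<integral>\<^sup>+t. (indicator {0<..<1} t * h t) * ennreal (t ^ Suc q / real (Suc q)) \<partial>lborel)"
  proof (intro nn_integral_cong)
    fix t :: real
    show "(indicator {0<..<1} t * h t) * (\<integral>\<^sup>+s. indicator {0<..<t} s * ennreal (s ^ q) \<partial>lborel)
        = (indicator {0<..<1} t * h t) * ennreal (t ^ Suc q / real (Suc q))"
    proof (cases "t \<in> {0<..<1}")
      case True
      then show ?thesis by (subst nn_integral_power_Ioo) auto
    qed simp
  qed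
  also have "\<dots> = (\<integral>\<^sup>+t. ennreal (1 / real (Suc q)) * (indicator {0<..<1} t *
      (ennreal (t ^ Suc q) * ennreal (letter_fun e t) * upper_int p v t)) \<partial>lborel)"
  proof (intro nn_integral_cong)
    fix t :: real
    have "ennreal (t ^ Suc q / real (Suc q)) = ennreal (1 / real (Suc q)) * ennreal (t ^ Suc q)"
      by (subst ennreal_mult'[symmetric]) auto
    then show "(indicator {0<..<1} t * h t) * ennreal (t ^ Suc q / real (Suc q)) =
      ennreal (1 / real (Suc q)) * (indicator {0<..<1} t *
      (ennreal (t ^ Suc q) * ennreal (letter_fun e t) * upper_int p v t))"
      by (simp only: h_def mult_ac)
  qed
  also have "\<dots> = ennreal (1 / real (Suc q)) * zeta_nn p (Suc q) r"
    unfolding Cons by (subst nn_integral_cmult) auto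
  finally show ?thesis .
qed

section \<open>Finiteness for positive parameters\<close>

text \<open>Since s(1 - s) times either letter function is at most 1, each letter costs one power of
  1 - s and one of 1/s; the rest is estimated at the lower limit \<open>y\<close>. The surplus
  exponent \<open>a\<close> is arbitrary because the induction hypothesis is applied with
  \<open>Suc a\<close>.\<close>

lemma upper_int_le:
  assumes "0 < y" "y < 1"
  shows "upper_int (length r + a) r y \<le> ennreal ((1 - y) ^ a / y ^ length r)"
  using assms
proof (induction r arbitrary: a y)
  case Nil
  then show ?case by simp
next
  case (Cons e r)
  define b where "b = length r"
  have "upper_int (length (e # r) + a) (e # r) y
      \<le> (\<integral>\<^sup>+s. ennreal ((1 - y) ^ a / y ^ Suc b) * indicator {y<..<1} s \<partial>lborel)"
    unfolding upper_int.simps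
  proof (intro nn_integral_mono)
    fix s :: real
    show "indicator {y<..<1} s * (ennreal (letter_fun e s) * upper_int (length (e # r) + a) r s)
        \<le> ennreal ((1 - y) ^ a / y ^ Suc b) * indicator {y<..<1} s"
    proof (cases "s \<in> {y<..<1}")
      case True
      then have s: "0 < s" "s < 1" "y < s" using Cons.prems by auto
      have "upper_int (length (e # r) + a) r s \<le> ennreal ((1 - s) ^ Suc a / s ^ b)"
        using Cons.IH[of s "Suc a"] s by (simp add: b_def)
      then have "ennreal (letter_fun e s) * upper_int (length (e # r) + a) r s
          \<le> ennreal (letter_fun e s) * ennreal ((1 - s) ^ Suc a / s ^ b)"
        by (rule mult_left_mono) simp
      also have "\<dots> = ennreal (letter_fun e s * ((1 - s) ^ Suc a / s ^ b))"
        using s by (intro ennreal_mult[symmetric]) (auto intro: letter_fun_nonneg)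
      also have "\<dots> \<le> ennreal ((1 - y) ^ a / y ^ Suc b)"
      proof (rule ennreal_leI)
        have "letter_fun e s * (s * (1 - s)) \<le> 1"
          using s by (auto simp: letter_fun_def)
        then have "letter_fun e s * (s * (1 - s)) * ((1 - s) ^ a / s ^ Suc b) \<le> 1 * ((1 - s) ^ a / s ^ Suc b)"
          using s by (intro mult_right_mono) auto
        also have "letter_fun e s * (s * (1 - s)) * ((1 - s) ^ a / s ^ Suc b)
            = letter_fun e s * ((1 - s) ^ Suc a / s ^ b)"
          using s by simp
        also have "1 * ((1 - s) ^ a / s ^ Suc b) \<le> (1 - y) ^ a / y ^ Suc b"
          using s Cons.prems unfolding mult_1
          by (intro frac_le power_mono zero_le_power zero_less_power) auto
        finally show "letter_fun e s * ((1 - s) ^ Suc a / s ^ b) \<le> (1 - y) ^ a / y ^ Suc b" .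
      qed
      finally show ?thesis using True by simp
    qed simp
  qed
  also have "\<dots> = ennreal ((1 - y) ^ a / y ^ Suc b) * ennreal (1 - y)"
    using Cons.prems by (subst nn_integral_cmult) auto
  also have "\<dots> \<le> ennreal ((1 - y) ^ a / y ^ Suc b) * 1"
    using Cons.prems by (intro mult_left_mono) auto
  finally show ?case by (simp add: b_def)
qed

lemma zeta_nn_large_finite:
  assumes "r \<noteq> []" "length r \<le> p" "length r \<le> q"
  shows "zeta_nn p q r < \<infinity>"
proof -
  obtain e v where r: "r = e # v" using assms(1) by (cases r) auto
  define b where "b = length v"
  \<comment> \<open>After \<open>upper_int_le\<close> has used up \<open>b\<close> powers of 1 - s
    and cost \<open>b\<close> powers of 1/s, one power of each of s and 1 - s is still available to
    absorb the pole of the head letter.\<close>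
  obtain a c where pq: "p = b + Suc a" "q = Suc b + c"
    using assms(2,3) le_Suc_ex[of "Suc b" p] le_Suc_ex[of "Suc b" q] by (auto simp: r b_def)
  have "zeta_nn p q r \<le> (\<integral>\<^sup>+s. indicator {0<..<1::real} s \<partial>lborel)"
    unfolding r zeta_nn.simps
  proof (intro nn_integral_mono)
    fix s :: real
    show "indicator {0<..<1} s * (ennreal (s ^ q) * ennreal (letter_fun e s) * upper_int p v s)
        \<le> indicator {0<..<1} s"
    proof (cases "s \<in> {0<..<1}")
      case True
      then have s: "0 < s" "s < 1" by auto
      have "ennreal (s ^ q) * ennreal (letter_fun e s) * upper_int p v s
          \<le> ennreal (s ^ q) * ennreal (letter_fun e s) * ennreal ((1 - s) ^ Suc a / s ^ b)"
        using upper_int_le[OF s, of v "Suc a"] by (intro mult_left_mono) (auto simp: pq b_def)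
      also have "\<dots> = ennreal (s ^ q * letter_fun e s * ((1 - s) ^ Suc a / s ^ b))"
        using s by (simp add: ennreal_mult[symmetric] letter_fun_nonneg del: times_divide_eq_right)
      also have "s ^ q * letter_fun e s * ((1 - s) ^ Suc a / s ^ b) = (letter_fun e s * (s * (1 - s))) * ((1 - s) ^ a * s ^ c)"
        using s by (simp add: pq power_add)
      also have "\<dots> \<le> 1 * (1 * 1)"
        using s by (intro mult_mono power_le_one) (auto simp: letter_fun_def)
      finally show ?thesis using True by (simp add: ennreal_leI)
    qed simp
  qed
  also have "\<dots> < \<infinity>" by simp
  finally show ?thesis .
qed

text \<open>Lists are reversed here, so \<open>True # v @ [False]\<close> is an admissible word.
  First the largest variable is expanded, raising \<open>p\<close>, then the smallest one, raising
  \<open>q\<close>; end letters that have become integrable are removed with the factors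
  \<open>x p\<close> and \<open>x q\<close>.\<close>

lemma zeta_nn_admissible_step:
  defines "x \<equiv> \<lambda>p. ennreal (1 / real (Suc p))"
  shows "zeta_nn p q (True # v @ [False]) = zeta_nn (Suc p) (Suc q) (True # v @ [False])
    + x q * zeta_nn (Suc p) (Suc q) (v @ [False])
    + x p * zeta_nn (Suc p) (Suc q) (True # v)
    + x p * (x q * zeta_nn (Suc p) (Suc q) v)"
proof -
  have "zeta_nn p q (True # v @ [False])
      = zeta_nn (Suc p) q (True # v @ [False]) + zeta_nn (Suc p) q (True # v @ [True])"
    using zeta_nn_snoc_False[of p q "True # v"] by simp
  also have "zeta_nn (Suc p) q (True # v @ [False])
      = zeta_nn (Suc p) (Suc q) (True # v @ [False]) + x q * zeta_nn (Suc p) (Suc q) (v @ [False])"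
    unfolding zeta_nn_Cons_True[of "Suc p" q] zeta_nn_Cons_False x_def ..
  also have "zeta_nn (Suc p) q (True # v @ [True])
      = x p * (zeta_nn (Suc p) (Suc q) (True # v) + x q * zeta_nn (Suc p) (Suc q) v)"
    using zeta_nn_snoc_True[of p q "True # v"]
    unfolding zeta_nn_Cons_True[of "Suc p" q v] zeta_nn_Cons_False x_def by simp
  finally show ?thesis by (simp only: distrib_left add.assoc)
qed

text \<open>The cases match the available reductions: the largest variable can be integrated out,
  the smallest one can, or the word is admissible.\<close>

lemma bword_end_letters_cases:
  fixes r :: "bool list"
  obtains "r = []" | v where "r = v @ [True]" | v where "r = False # v" | v where "r = True # v @ [False]"
proof (cases r rule: rev_cases)
  case (snoc v e)
  show thesis
  proof (cases e)
    case True
    then show thesis using snoc that(2) by blast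
  next
    case False
    show thesis
    proof (cases v)
      case Nil
      then show thesis using snoc False that(3)[of "[]"] by simp
    next
      case (Cons e' v')
      then show thesis using snoc False that(3)[of "v' @ [False]"] that(4)[of v'] by (cases e') auto
    qed
  qed
qed (use that in blast)

text \<open>At parameters raised by the length of \<open>r\<close> the integral is finite. Each
  diagonal step down adds only the same word at larger parameters and shorter words at positive
  parameters, so \<open>p\<close> and \<open>q\<close> are reached, even when they are 0.\<close>

lemma zeta_nn_finite_descent:
  assumes "\<And>v p q. length v < length r \<Longrightarrow> 0 < p \<Longrightarrow> 0 < q \<Longrightarrow> zeta_nn p q v < \<infinity>"
    and r: "r = True # v @ [False]"
  shows "zeta_nn p q r < \<infinity>"
proof -
  have "zeta_nn (p + d - e) (q + d - e) r < \<infinity>" if "d = length r" "e \<le> d" for d e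
    using that(2)
  proof (induction e)
    case 0
    show ?case using that(1) r by (intro zeta_nn_large_finite) auto
  next
    case (Suc e)
    define p' q' where "p' = p + d - Suc e" and "q' = q + d - Suc e"
    have eq: "p + d - e = Suc p'" "q + d - e = Suc q'" using Suc.prems by (auto simp: p'_def q'_def)
    have "zeta_nn (Suc p') (Suc q') r < \<infinity>" using Suc eq by simp
    then have "zeta_nn p' q' r < \<infinity>"
      unfolding r zeta_nn_admissible_step[of p' q' v]
      using assms(1)[of "v @ [False]" "Suc p'" "Suc q'"] assms(1)[of "True # v" "Suc p'" "Suc q'"]
        assms(1)[of v "Suc p'" "Suc q'"]
      by (auto simp: r ennreal_mult_less_top simp del: zeta_nn.simps of_nat_Suc)
    then show ?case by (simp add: p'_def q'_def)
  qed
  from this[of "length r" "length r"] show ?thesis by simp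
qed

lemma zeta_nn_finite:
  assumes "0 < p" "0 < q"
  shows "zeta_nn p q r < \<infinity>"
  using assms
proof (induction "length r" arbitrary: r p q rule: less_induct)
  case less
  obtain p' q' where pq: "p = Suc p'" "q = Suc q'"
    using less.prems by (cases p; cases q) auto
  show ?case
  proof (cases r rule: bword_end_letters_cases)
    case 1
    then show ?thesis by simp
  next
    case (2 v)
    then show ?thesis using less(1)[of v p q] less.prems
      unfolding pq by (simp add: zeta_nn_snoc_True ennreal_mult_less_top del: of_nat_Suc)
  next
    case (3 v)
    then show ?thesis using less(1)[of v p q] less.prems
      unfolding pq by (simp add: zeta_nn_Cons_False ennreal_mult_less_top del: zeta_nn.simps(2) of_nat_Suc)
  next
    case (4 v)
    show ?thesis by (rule zeta_nn_finite_descent[OF less(1) 4])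
  qed
qed

section \<open>Comparison with integrals over the simplex\<close>

text \<open>The integrand without the condition and the power attached to the smallest variable. The
  ordering is a product of 0-1 factors, so a further variable only contributes further
  factors.\<close>

definition chain_weight :: "nat \<Rightarrow> bword \<Rightarrow> (nat \<Rightarrow> real) \<Rightarrow> ennreal" where
  "chain_weight p u t = (if t 0 < 1 then 1 else 0) * ennreal ((1 - t 0) ^ p)
     * (\<Prod>i<length u - 1. if t (Suc i) < t i then 1 else 0)
     * (\<Prod>i<length u. ennreal (letter_fun (u ! i) (t i)))"

lemma borel_measurable_PiM_component:
  "i \<in> I \<Longrightarrow> (\<lambda>t. t i) \<in> borel_measurable (PiM I (\<lambda>_. lborel :: real measure))"
  using measurable_component_singleton[of i I "\<lambda>_. lborel :: real measure"] by simp

lemma borel_measurable_chain_weight: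
  assumes "u \<noteq> []"
  shows "chain_weight p u \<in> borel_measurable (PiM {..<length u} (\<lambda>_. lborel))"
proof -
  let ?M = "PiM {..<length u} (\<lambda>_. lborel :: real measure)"
  have [measurable]: "(\<lambda>t. t 0) \<in> borel_measurable ?M"
    using assms by (intro borel_measurable_PiM_component) auto
  have 1: "(\<lambda>t. \<Prod>i<length u - 1. if t (Suc i) < t i then 1 else 0 :: ennreal) \<in> borel_measurable ?M"
  proof (rule borel_measurable_prod_ennreal)
    fix i assume i: "i \<in> {..<length u - 1}"
    have [measurable]: "(\<lambda>t. t i) \<in> borel_measurable ?M" "(\<lambda>t. t (Suc i)) \<in> borel_measurable ?M"
      using i by (auto intro!: borel_measurable_PiM_component)
    show "(\<lambda>t. if t (Suc i) < t i then 1 else 0 :: ennreal) \<in> borel_measurable ?M"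
      by measurable
  qed
  have 2: "(\<lambda>t. \<Prod>i<length u. ennreal (letter_fun (u ! i) (t i))) \<in> borel_measurable ?M"
  proof (rule borel_measurable_prod_ennreal)
    fix i assume i: "i \<in> {..<length u}"
    have [measurable]: "(\<lambda>t. t i) \<in> borel_measurable ?M"
      using i by (auto intro!: borel_measurable_PiM_component)
    show "(\<lambda>t. ennreal (letter_fun (u ! i) (t i))) \<in> borel_measurable ?M"
      by measurable
  qed
  note [measurable] = 1 2
  show ?thesis unfolding chain_weight_def by measurable
qed

text \<open>Induction appends the smallest variable, which becomes the outermost integration. The
  arbitrary function \<open>G\<close> of that variable makes the induction work: it carries the
  comparison with the next variable, and at the end positivity and the power s^q.\<close>

lemma nn_integral_chain_weight:
  fixes G :: "real \<Rightarrow> ennreal"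
  assumes "G \<in> borel_measurable borel"
  shows "(\<integral>\<^sup>+t. chain_weight p (v @ [e]) t * G (t (length v)) \<partial>PiM {..<Suc (length v)} (\<lambda>_. lborel))
    = (\<integral>\<^sup>+s. indicator {..<1} s * (ennreal (letter_fun e s) * upper_int p (rev v) s * G s) \<partial>lborel)"
  using assms
proof (induction v arbitrary: e G rule: rev_induct)
  case Nil
  note [measurable] = Nil
  interpret product_sigma_finite "\<lambda>_::nat. lborel :: real measure" ..
  have "{..<Suc (length ([]::bword))} = {0}" by auto
  then have "(\<integral>\<^sup>+t. chain_weight p ([] @ [e]) t * G (t (length ([]::bword))) \<partial>PiM {..<Suc (length ([]::bword))} (\<lambda>_. lborel))
      = (\<integral>\<^sup>+t. (\<lambda>s. (if s < 1 then 1 else 0) * ennreal ((1 - s) ^ p) * ennreal (letter_fun e s) * G s) (t 0)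
          \<partial>PiM {0 :: nat} (\<lambda>_. lborel))"
    by (simp add: chain_weight_def)
  also have "\<dots> = (\<integral>\<^sup>+s. (if s < 1 then 1 else 0) * ennreal ((1 - s) ^ p) * ennreal (letter_fun e s) * G s \<partial>lborel)"
    by (rule product_nn_integral_singleton) measurable
  also have "\<dots> = (\<integral>\<^sup>+s. indicator {..<1} s * (ennreal (letter_fun e s) * upper_int p (rev []) s * G s) \<partial>lborel)"
    by (auto intro!: nn_integral_cong simp: indicator_def mult_ac)
  finally show ?case .
next
  case (snoc e' v)
  note [measurable] = snoc.prems
  interpret product_sigma_finite "\<lambda>_::nat. lborel :: real measure" ..
  define l where "l = length v"
  let ?u = "(v @ [e']) @ [e]"
  have ins: "{..<Suc (length (v @ [e']))} = insert (Suc l) {..<Suc l}"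
    by (auto simp: l_def)
  have meas: "(\<lambda>t. chain_weight p ?u t * G (t (length (v @ [e'])))) \<in>
      borel_measurable (PiM (insert (Suc l) {..<Suc l}) (\<lambda>_. lborel))"
  proof -
    have "chain_weight p ?u \<in> borel_measurable (PiM (insert (Suc l) {..<Suc l}) (\<lambda>_. lborel))"
      using borel_measurable_chain_weight[of ?u p] ins by simp
    moreover have "(\<lambda>t. G (t (Suc l))) \<in> borel_measurable (PiM (insert (Suc l) {..<Suc l}) (\<lambda>_. lborel))"
      by (rule measurable_compose[OF borel_measurable_PiM_component snoc.prems]) simp
    ultimately show ?thesis by (simp add: l_def)
  qed
  have weight: "chain_weight p ?u (x(Suc l := y)) * G ((x(Suc l := y)) (length (v @ [e'])))
      = ennreal (letter_fun e y) * G y * (chain_weight p (v @ [e']) x * (if y < x l then 1 else 0))" for x y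
  proof -
    have "(\<Prod>i<Suc l. ennreal (letter_fun (?u ! i) ((x(Suc l := y)) i)))
        = (\<Prod>i<Suc l. ennreal (letter_fun ((v @ [e']) ! i) (x i)))"
      by (rule prod.cong) (auto simp: nth_append l_def)
    moreover have "(\<Prod>i<l. if (x(Suc l := y)) (Suc i) < (x(Suc l := y)) i then 1 else 0 :: ennreal)
        = (\<Prod>i<l. if x (Suc i) < x i then 1 else 0)"
      by (rule prod.cong) auto
    moreover have "?u ! Suc l = e" by (simp add: nth_append l_def)
    moreover have "length ?u = Suc (Suc l)" "length (v @ [e']) = Suc l" by (simp_all add: l_def)
    ultimately show ?thesis
      by (simp add: chain_weight_def prod.lessThan_Suc[of _ "Suc l"]
          prod.lessThan_Suc[of "\<lambda>i. if _ i then _ else _" l] mult_ac del: prod.lessThan_Suc)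
  qed
  have inner: "(\<integral>\<^sup>+x. chain_weight p (v @ [e']) x * (if y < x l then 1 else 0) \<partial>PiM {..<Suc l} (\<lambda>_. lborel))
      = upper_int p (e' # rev v) y" for y
  proof -
    have "(\<integral>\<^sup>+x. chain_weight p (v @ [e']) x * (if y < x l then 1 else 0) \<partial>PiM {..<Suc l} (\<lambda>_. lborel))
        = (\<integral>\<^sup>+s. indicator {..<1} s * (ennreal (letter_fun e' s) * upper_int p (rev v) s
            * (if y < s then 1 else 0)) \<partial>lborel)"
      \<comment> \<open>The test function is the indicator of \<open>y < s\<close>, which cuts the
        integral down to the range used in \<open>upper_int\<close>.\<close>
      using snoc.IH[of "\<lambda>s. if y < s then 1 else 0" e'] by (simp add: l_def)
    also have "\<dots> = upper_int p (e' # rev v) y"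
      by (auto intro!: nn_integral_cong simp: indicator_def)
    finally show ?thesis .
  qed
  have "(\<integral>\<^sup>+t. chain_weight p ?u t * G (t (length (v @ [e'])))
        \<partial>PiM {..<Suc (length (v @ [e']))} (\<lambda>_. lborel))
      = (\<integral>\<^sup>+y. \<integral>\<^sup>+x. ennreal (letter_fun e y) * G y * (chain_weight p (v @ [e']) x * (if y < x l then 1 else 0))
          \<partial>PiM {..<Suc l} (\<lambda>_. lborel) \<partial>lborel)"
    unfolding ins by (subst product_nn_integral_insert_rev[OF _ _ meas]) (auto simp only: weight finite_lessThan lessThan_iff)
  also have "\<dots> = (\<integral>\<^sup>+y. ennreal (letter_fun e y) * G y * upper_int p (e' # rev v) y \<partial>lborel)"
  proof (intro nn_integral_cong)
    fix y :: real
    have [measurable]: "chain_weight p (v @ [e']) \<in> borel_measurable (PiM {..<Suc l} (\<lambda>_. lborel))"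
      using borel_measurable_chain_weight[of "v @ [e']" p] by (simp add: l_def)
    have [measurable]: "(\<lambda>x. x l :: real) \<in> borel_measurable (PiM {..<Suc l} (\<lambda>_. lborel))"
      by (rule borel_measurable_PiM_component) simp
    show "(\<integral>\<^sup>+x. ennreal (letter_fun e y) * G y * (chain_weight p (v @ [e']) x * (if y < x l then 1 else 0))
          \<partial>PiM {..<Suc l} (\<lambda>_. lborel)) = ennreal (letter_fun e y) * G y * upper_int p (e' # rev v) y"
      by (subst nn_integral_cmult) (measurable, simp only: inner)
  qed
  also have "\<dots> = (\<integral>\<^sup>+s. indicator {..<1} s * (ennreal (letter_fun e s) * upper_int p (rev (v @ [e'])) s * G s) \<partial>lborel)"
  proof (intro nn_integral_cong)
    fix y :: real
    \<comment> \<open>The range of integration is empty for \<open>y\<close> at least 1, so the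
      indicator of \<open>{..<1}\<close> may be inserted.\<close>
    have "upper_int p (e' # rev v) y = 0" if "1 \<le> y"
      using that by simp
    then show "ennreal (letter_fun e y) * G y * upper_int p (e' # rev v) y
        = indicator {..<1} y * (ennreal (letter_fun e y) * upper_int p (rev (v @ [e'])) y * G y)"
      by (cases "y < 1") (auto simp: mult_ac simp del: upper_int.simps)
  qed
  finally show ?case .
qed

text \<open>On the simplex the chain of inequalities puts every coordinate strictly between 0 and 1,
  so all factors are nonnegative and \<open>ennreal\<close> is multiplicative. Off the simplex some
  0-1 factor vanishes.\<close>

lemma chain_weight_open_simplex:
  fixes t :: "nat \<Rightarrow> real" and p q :: nat
  assumes "u \<noteq> []" and "t \<in> space (PiM {..<length u} (\<lambda>_. lborel))"
  defines "f \<equiv> indicator (open_simplex (length u)) t *\<^sub>R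
      ((1 - t 0) ^ p * (\<Prod>i<length u. letter_fun (u ! i) (t i)) * t (length u - 1) ^ q)"
  shows "0 \<le> f \<and> ennreal f = chain_weight p u t *
      (if 0 < t (length u - 1) then ennreal (t (length u - 1) ^ q) else 0)"
proof (cases "t \<in> open_simplex (length u)")
  case True
  have chain: "t (Suc i) < t i" if "i < length u - 1" for i
    using True that by (auto simp: open_simplex_def)
  have t0: "t 0 < 1" and tl: "0 < t (length u - 1)"
    using True by (auto simp: open_simplex_def)
  have lt1: "i < length u \<Longrightarrow> t i < 1" for i
  proof (induction i)
    case (Suc i)
    then have "i < length u - 1" by simp
    then show ?case using Suc chain[of i] by simp
  qed (use t0 in simp)
  \<comment> \<open>Positivity spreads upward from the smallest coordinate, hence the induction on
    the distance from the last index.\<close>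
  have gt0: "0 < t (length u - 1 - i)" for i
  proof (induction i)
    case (Suc i)
    show ?case
    proof (cases "i < length u - 1")
      case True
      then have "Suc (length u - 1 - Suc i) = length u - 1 - i" by simp
      moreover have "length u - 1 - Suc i < length u - 1" using True by linarith
      ultimately show ?thesis using Suc chain[of "length u - 1 - Suc i"] by simp
    qed (use Suc in simp)
  qed (use tl in simp)
  have lf: "0 \<le> letter_fun (u ! i) (t i)" if "i < length u" for i
    using lt1[OF that] gt0[of "length u - 1 - i"] that by (intro letter_fun_nonneg) auto
  have "(\<Prod>i<length u - 1. if t (Suc i) < t i then 1 else 0 :: ennreal) = 1"
    using chain by (intro prod.neutral) auto
  moreover have "(\<Prod>i<length u. ennreal (letter_fun (u ! i) (t i))) = ennreal (\<Prod>i<length u. letter_fun (u ! i) (t i))"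
    using lf by (intro prod_ennreal) auto
  moreover have "0 \<le> (\<Prod>i<length u. letter_fun (u ! i) (t i))"
    using lf by (intro prod_nonneg) auto
  ultimately show ?thesis
    using True t0 tl by (simp add: f_def chain_weight_def ennreal_mult)
next
  case False
  have "t \<in> {..<length u} \<rightarrow>\<^sub>E UNIV"
    using assms(2) by (simp add: space_PiM)
  with False consider "\<not> t 0 < 1" | "\<not> 0 < t (length u - 1)" | i where "Suc i < length u" "\<not> t (Suc i) < t i"
    by (auto simp: open_simplex_def)
  then show ?thesis
  proof cases
    case (3 i)
    then have "i < length u - 1" by simp
    with 3 have "(\<Prod>i<length u - 1. if t (Suc i) < t i then 1 else 0 :: ennreal) = 0"
      by (intro prod_zero bexI[of _ i]) auto
    then show ?thesis using False by (simp add: f_def chain_weight_def)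
  qed (use False in \<open>simp_all add: f_def chain_weight_def\<close>)
qed

lemma zeta_int_eq_zeta_nn: "zeta_int u p q = enn2real (zeta_nn p q (rev u))"
proof (cases u rule: rev_cases)
  case Nil
  then show ?thesis by (simp add: zeta_int_def)
next
  case (snoc v e)
  let ?M = "PiM {..<length u} (\<lambda>_. lborel :: real measure)"
  define f where "f t = indicator (open_simplex (length u)) t *\<^sub>R
      ((1 - t 0) ^ p * (\<Prod>i<length u. letter_fun (u ! i) (t i)) * t (length u - 1) ^ q)" for t :: "nat \<Rightarrow> real"
  define G where "G s = (if 0 < s then ennreal (s ^ q) else 0)" for s :: real
  have G: "G \<in> borel_measurable borel" unfolding G_def by measurable
  have ne: "u \<noteq> []" using snoc by simp
  have f: "0 \<le> f t" "ennreal (f t) = chain_weight p u t * G (t (length v))" if "t \<in> space ?M" for t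
    using chain_weight_open_simplex[OF ne that, of p q] by (simp_all add: f_def G_def snoc)
  have W: "(\<lambda>t. chain_weight p u t * G (t (length v))) \<in> borel_measurable ?M"
    using ne snoc
    by (intro borel_measurable_times_ennreal borel_measurable_chain_weight
        measurable_compose[OF borel_measurable_PiM_component G]) auto
  \<comment> \<open>Measurability of \<open>f\<close> is inherited from the weight, without treating
    the simplex as a measurable set.\<close>
  have "f t = enn2real (chain_weight p u t * G (t (length v)))" if "t \<in> space ?M" for t
    using f[OF that] by (metis enn2real_ennreal)
  then have "f \<in> borel_measurable ?M"
    using W by (subst measurable_cong[where g = "\<lambda>t. enn2real (chain_weight p u t * G (t (length v)))"]) auto
  \<comment> \<open>This covers divergent integrals too: both sides are then 0 by
    convention.\<close>
  then have "integral\<^sup>L ?M f = enn2real (\<integral>\<^sup>+t. ennreal (f t) \<partial>?M)"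
    using f by (intro integral_eq_nn_integral) auto
  also have "(\<integral>\<^sup>+t. ennreal (f t) \<partial>?M) = (\<integral>\<^sup>+t. chain_weight p u t * G (t (length v)) \<partial>?M)"
    using f by (intro nn_integral_cong) auto
  also have "\<dots> = (\<integral>\<^sup>+s. indicator {..<1} s * (ennreal (letter_fun e s) * upper_int p (rev v) s * G s) \<partial>lborel)"
    using nn_integral_chain_weight[OF G, where p = p and v = v and e = e] by (simp add: snoc)
  also have "\<dots> = zeta_nn p q (rev u)"
    by (auto intro!: nn_integral_cong simp: snoc G_def indicator_def mult_ac)
  finally show ?thesis
    using ne unfolding zeta_int_def set_lebesgue_integral_def f_def by simp
qed

lemma zeta_int_Cons_True: "zeta_int (True # v) (Suc p) q = zeta_int v (Suc p) q / real (Suc p)"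
  by (simp add: zeta_int_eq_zeta_nn zeta_nn_snoc_True enn2real_mult del: of_nat_Suc)

lemma zeta_int_snoc_False: "zeta_int (v @ [False]) p (Suc q) = zeta_int v p (Suc q) / real (Suc q)"
  by (simp add: zeta_int_eq_zeta_nn zeta_nn_Cons_False enn2real_mult del: of_nat_Suc zeta_nn.simps)

text \<open>\<open>enn2real\<close> is additive only on finite values. All terms on the right have
  positive parameters, so \<open>zeta_nn_finite\<close> applies to each of them.\<close>

lemma zeta_int_admissible_step:
  "zeta_int (False # v @ [True]) p q = zeta_int (False # v @ [True]) (Suc p) (Suc q)
    + zeta_int (False # v) (Suc p) (Suc q) / real (Suc q)
    + zeta_int (v @ [True]) (Suc p) (Suc q) / real (Suc p)
    + zeta_int v (Suc p) (Suc q) / (real (Suc p) * real (Suc q))"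
proof -
  have fin: "zeta_nn (Suc p) (Suc q) r < top" for r
    using zeta_nn_finite[of "Suc p" "Suc q" r] by simp
  show ?thesis
    by (simp add: zeta_int_eq_zeta_nn zeta_nn_admissible_step[of p q "rev v"] enn2real_plus fin
      enn2real_mult ennreal_mult_less_top del: of_nat_Suc zeta_nn.simps)
qed

section \<open>Truncated sums\<close>

lemma decr_seqs_0 [simp]: "decr_seqs 0 A = {[]}"
  by (auto simp: decr_seqs_def)

lemma finite_decr_seqs:
  assumes "finite A"
  shows "finite (decr_seqs r A)"
proof (rule finite_subset)
  show "decr_seqs r A \<subseteq> {ns. set ns \<subseteq> A \<and> length ns = r}"
    by (auto simp: decr_seqs_def)
  show "finite {ns. set ns \<subseteq> A \<and> length ns = r}"
    using assms by (rule finite_lists_length_eq)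
qed

text \<open>The head is the largest entry: either it equals \<open>Suc q\<close> and the tail stays
  below it, or all entries are at most \<open>q\<close>.\<close>

lemma decr_seqs_Suc_greaterThanAtMost:
  assumes "p \<le> q"
  shows "decr_seqs (Suc r) {p<..Suc q} =
    decr_seqs (Suc r) {p<..q} \<union> (#) (Suc q) ` decr_seqs r {p<..q}" (is "?L = ?R")
proof
  show "?L \<subseteq> ?R"
  proof
    fix ns assume ns: "ns \<in> ?L"
    then obtain a as where a: "ns = a # as" by (cases ns) (auto simp: decr_seqs_def)
    have as: "\<forall>x\<in>set as. p < x \<and> x < a" "length as = r" "sorted_wrt (>) as" "p < a" "a \<le> Suc q"
      using ns by (auto simp: decr_seqs_def a)
    show "ns \<in> ?R"
    proof (cases "a = Suc q")
      case True
      then have "as \<in> decr_seqs r {p<..q}" using as by (force simp: decr_seqs_def)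
      then show ?thesis using True by (simp add: a)
    next
      case False
      then show ?thesis using as by (force simp: a decr_seqs_def)
    qed
  qed
  show "?R \<subseteq> ?L"
    using assms by (force simp: decr_seqs_def)
qed

lemma zeta_trunc_Nil [simp]: "zeta_trunc p q [] = 1"
  by (simp add: zeta_trunc_def)

lemma zeta_trunc_self: "zeta_trunc p p c = (if c = [] then 1 else 0)"
proof (cases c)
  case (Cons a d)
  then have "decr_seqs (length c) {p<..p} = {}" by (auto simp: decr_seqs_def)
  with Cons show ?thesis by (simp add: zeta_trunc_def)
qed simp

lemma phi_Cons: "phi p (Suc q) (a # c) = 1 / real (Suc q) ^ a * zeta_trunc p q c"
proof -
  have "{p<..<Suc q} = {p<..q}" by auto
  then show ?thesis by (simp add: phi_def zeta_trunc_def)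
qed

text \<open>The terms whose largest index equals the new bound \<open>Suc q\<close> are exactly
  those collected by \<open>phi\<close>.\<close>

lemma zeta_trunc_Suc:
  assumes "p \<le> q" and "c \<noteq> []"
  shows "zeta_trunc p (Suc q) c = zeta_trunc p q c + phi p (Suc q) c"
proof -
  obtain a d where c: "c = a # d" using assms(2) by (cases c) auto
  define h where "h ns = (\<Prod>i<length c. 1 / real (ns ! i) ^ (c ! i))" for ns :: "nat list"
  define r where "r = length d"
  have disj: "decr_seqs (Suc r) {p<..q} \<inter> (#) (Suc q) ` decr_seqs r {p<..q} = {}"
    by (auto simp: decr_seqs_def)
  have "zeta_trunc p (Suc q) c = (\<Sum>ns\<in>decr_seqs (Suc r) {p<..Suc q}. h ns)"
    by (simp add: zeta_trunc_def h_def c r_def)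
  also have "\<dots> = (\<Sum>ns\<in>decr_seqs (Suc r) {p<..q}. h ns)
      + (\<Sum>ns\<in>(#) (Suc q) ` decr_seqs r {p<..q}. h ns)"
    unfolding decr_seqs_Suc_greaterThanAtMost[OF assms(1)]
    by (rule sum.union_disjoint) (use disj in \<open>auto intro!: finite_imageI finite_decr_seqs\<close>)
  also have "(\<Sum>ns\<in>(#) (Suc q) ` decr_seqs r {p<..q}. h ns)
      = (\<Sum>ns\<in>decr_seqs r {p<..q}. h (Suc q # ns))"
    by (subst sum.reindex) (auto simp: inj_on_def)
  also have "\<dots> = 1 / real (Suc q) ^ a * zeta_trunc p q d"
    unfolding h_def c zeta_trunc_def length_Cons prod.lessThan_Suc_shift
    by (simp add: r_def sum_distrib_left)
  also have "(\<Sum>ns\<in>decr_seqs (Suc r) {p<..q}. h ns) = zeta_trunc p q c"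
    by (simp add: zeta_trunc_def h_def c r_def)
  finally show ?thesis by (simp add: phi_Cons c)
qed

section \<open>Compositions of words with one letter prepended\<close>

lemma comp_of_word_eqI:
  assumes "composition c" and "comp_word c = u"
  shows "comp_of_word u = c"
  unfolding comp_of_word_def
  using assms comp_word_inj by (intro the_equality) (auto simp: inj_on_def)

lemma comp_of_word_Nil [simp]: "comp_of_word [] = []"
  by (rule comp_of_word_eqI) (auto simp: composition_def)

lemma comp_of_word_eq_Nil_iff:
  assumes "u = [] \<or> last u"
  shows "comp_of_word u = [] \<longleftrightarrow> u = []"
  using comp_of_word(2)[of u] assms by fastforce

lemma comp_of_word_True:
  assumes "u = [] \<or> last u"
  shows "comp_of_word (True # u) = 1 # comp_of_word u"
  using assms comp_of_word[of u]
  by (intro comp_of_word_eqI) (auto simp: composition_def)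

lemma comp_of_word_False:
  assumes "u \<noteq> []" "last u"
  obtains a c where "comp_of_word u = a # c" "comp_of_word (False # u) = Suc a # c"
proof -
  have *: "composition (comp_of_word u)" "comp_word (comp_of_word u) = u"
    using comp_of_word[of u] assms by auto
  obtain a c where ac: "comp_of_word u = a # c"
    using assms comp_of_word_eq_Nil_iff[of u] by (cases "comp_of_word u") auto
  have "1 \<le> a" using *(1) by (simp add: ac composition_def)
  then obtain b where "a = Suc b" by (cases a) auto
  then have "comp_of_word (False # u) = Suc a # c"
    using * by (intro comp_of_word_eqI) (auto simp: composition_def ac)
  with ac that show thesis by blast
qed

text \<open>A leading 1 prepends an entry 1 and a leading 0 raises the first entry by 1; either way
  one factor 1/(q+1) splits off. This supplies the recurrences for \<phi> and \<psi> in
  \<open>double_telescope\<close>.\<close>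

lemma phi_comp_of_word_Cons:
  assumes "u = [] \<or> last u" and "e \<or> u \<noteq> []"
  shows "phi p (Suc q) (comp_of_word (e # u)) =
    (if e then zeta_trunc p q (comp_of_word u) else phi p (Suc q) (comp_of_word u)) / real (Suc q)"
proof (cases e)
  case True
  then show ?thesis using assms by (simp add: comp_of_word_True phi_Cons)
next
  case False
  then obtain a c where "comp_of_word u = a # c" "comp_of_word (False # u) = Suc a # c"
    using comp_of_word_False[of u] assms by blast
  then show ?thesis using False by (simp add: phi_Cons field_simps)
qed

section \<open>Telescoping over subwords\<close>

text \<open>Indices beyond \<open>i\<close> where \<open>e\<close> fails have difference 0 and may
  be restored, while \<open>i\<close> itself drops out; a full telescoping sum from
  \<open>Suc i\<close> remains.\<close>

lemma telescope_sum_lessThan: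
  fixes H :: "nat \<Rightarrow> real"
  assumes "i < k" and "\<And>j. i < j \<Longrightarrow> j < k \<Longrightarrow> \<not> e j \<Longrightarrow> H j = H (Suc j)" and "\<not> e i"
  shows "(\<Sum>j<k. if i \<le> j \<and> e j then H j - H (Suc j) else 0) = H (Suc i) - H k"
proof -
  have "(\<Sum>j<k. if i \<le> j \<and> e j then H j - H (Suc j) else 0)
      = (\<Sum>j<k. if j \<in> {Suc i..<k} then H j - H (Suc j) else 0)"
  proof (rule sum.cong)
    fix j assume j: "j \<in> {..<k}"
    show "(if i \<le> j \<and> e j then H j - H (Suc j) else 0) = (if j \<in> {Suc i..<k} then H j - H (Suc j) else 0)"
      using assms j by (cases "i = j") auto
  qed simp
  also have "\<dots> = (\<Sum>j\<in>{Suc i..<k}. H j - H (Suc j))"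
    by (subst sum.inter_restrict[symmetric]) (auto intro!: sum.cong)
  also have "\<dots> = - (\<Sum>j\<in>{Suc i..<k}. H (Suc j) - H j)"
    by (simp add: sum_negf[symmetric])
  also have "\<dots> = H (Suc i) - H k"
    using assms(1) by (simp add: sum_Suc_diff')
  finally show ?thesis .
qed

lemma telescope_sum_atMost:
  fixes H :: "nat \<Rightarrow> real"
  assumes "j < k" and "\<And>i. i < j \<Longrightarrow> e i \<Longrightarrow> H i = H (Suc i)" and "e j"
  shows "(\<Sum>i<k. if i \<le> j \<and> \<not> e i then H (Suc i) - H i else 0) = H j - H 0"
proof -
  have "(\<Sum>i<k. if i \<le> j \<and> \<not> e i then H (Suc i) - H i else 0)
      = (\<Sum>i<k. if i \<in> {..<j} then H (Suc i) - H i else 0)"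
  proof (rule sum.cong)
    fix i assume "i \<in> {..<k}"
    show "(if i \<le> j \<and> \<not> e i then H (Suc i) - H i else 0) = (if i \<in> {..<j} then H (Suc i) - H i else 0)"
      using assms by (cases "i = j") auto
  qed simp
  also have "\<dots> = (\<Sum>i<j. H (Suc i) - H i)"
    using assms(1) by (subst sum.inter_restrict[symmetric]) (auto intro!: sum.cong)
  also have "\<dots> = H j - H 0"
    by (rule sum_lessThan_telescope)
  finally show ?thesis .
qed

text \<open>Here \<open>e i\<close> is the letter \<open>\<epsilon>\<^bsub>i+1\<^esub>\<close>, \<open>Z i j\<close> and \<open>Z' i j\<close> are the values at \<open>\<epsilon>\<^bsub>i+1\<^esub>\<dots>\<epsilon>\<^sub>j\<close> for the
  new and the old parameters, and \<open>B i\<close>, \<open>\<phi> i\<close>, \<open>A j\<close>, \<open>\<psi> j\<close> belong to the compositions \<open>b\<close> and \<open>a\<close>.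
  The product \<open>G i j = \<phi> i * \<psi> j * Z i j\<close> does not change when \<open>i\<close> moves past a letter 1 or \<open>j\<close> past
  a letter 0, so in each single sum the skipped terms may be put back to make it telescope.\<close>

lemma double_telescope:
  fixes \<phi> \<psi> A B :: "nat \<Rightarrow> real" and Z Z' :: "nat \<Rightarrow> nat \<Rightarrow> real" and p q :: real
  assumes pq: "p \<noteq> 0" "q \<noteq> 0"
    and k: "0 < k" "\<not> e 0" "e (k - 1)"
    and \<phi>0: "\<phi> 0 = 0" and \<psi>k: "\<psi> k = 0"
    and \<phi>: "\<And>i. i < k \<Longrightarrow> \<phi> (Suc i) = (if e i then \<phi> i else B i) / p"
    and \<psi>: "\<And>j. j < k \<Longrightarrow> \<psi> j = (if e j then A (Suc j) else \<psi> (Suc j)) / q"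
    and Zl: "\<And>i j. i < j \<Longrightarrow> j \<le> k \<Longrightarrow> e i \<Longrightarrow> Z i j = Z (Suc i) j / p"
    and Zr: "\<And>i j. i \<le> j \<Longrightarrow> j < k \<Longrightarrow> \<not> e j \<Longrightarrow> Z i (Suc j) = Z i j / q"
    and Z': "\<And>i j. i < j \<Longrightarrow> j < k \<Longrightarrow> \<not> e i \<Longrightarrow> e j \<Longrightarrow>
        Z' i (Suc j) = Z i (Suc j) + Z i j / q + Z (Suc i) (Suc j) / p + Z (Suc i) j / (p * q)"
  shows "(\<Sum>i<k. \<Sum>j<k. if i \<le> j \<and> \<not> e i \<and> e j then B i * A (Suc j) * Z' i (Suc j) else 0)
    = (\<Sum>i<k. \<Sum>j<k. if i \<le> j \<and> \<not> e i \<and> e j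
          then (B i + \<phi> i) * (A (Suc j) + \<psi> (Suc j)) * Z i (Suc j) else 0)
    + (\<Sum>i<k. if \<not> e i then B i * \<psi> (Suc i) * Z i (Suc i) else 0)
    + (\<Sum>i<k. if e i then \<phi> i * A (Suc i) * Z i (Suc i) else 0)
    + (\<Sum>i=1..<k. \<phi> i * \<psi> i * Z i i)"
proof -
  define P where "P i j \<longleftrightarrow> i \<le> j \<and> \<not> e i \<and> e j" for i j
  define G where "G i j = \<phi> i * \<psi> j * Z i j" for i j
  have less: "i < j" if "P i j" for i j
    using that by (cases "i = j") (auto simp: P_def)
  have Gl: "G i j = G (Suc i) j" if "i < j" "j \<le> k" "e i" for i j
    using that Zl[of i j] \<phi>[of i] pq by (simp add: G_def)
  have Gr: "G i j = G i (Suc j)" if "i \<le> j" "j < k" "\<not> e j" for i j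
    using that Zr[of i j] \<psi>[of j] pq by (simp add: G_def)
  \<comment> \<open>For fixed \<open>i\<close> this telescopes in \<open>j\<close>. The upper end
    vanishes by \<open>\<psi> k = 0\<close>; the lower end is a one-letter term for the letter
    0.\<close>
  have T1: "(\<Sum>i<k. \<Sum>j<k. if P i j then B i * (\<psi> j * Z i j - \<psi> (Suc j) * Z i (Suc j)) else 0)
      = (\<Sum>i<k. if \<not> e i then B i * \<psi> (Suc i) * Z i (Suc i) else 0)"
  proof (rule sum.cong)
    fix i assume i: "i \<in> {..<k}"
    show "(\<Sum>j<k. if P i j then B i * (\<psi> j * Z i j - \<psi> (Suc j) * Z i (Suc j)) else 0)
        = (if \<not> e i then B i * \<psi> (Suc i) * Z i (Suc i) else 0)"
    proof (cases "e i")
      case False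
      have "(\<Sum>j<k. if P i j then B i * (\<psi> j * Z i j - \<psi> (Suc j) * Z i (Suc j)) else 0)
        = B i * (\<Sum>j<k. if i \<le> j \<and> e j then \<psi> j * Z i j - \<psi> (Suc j) * Z i (Suc j) else 0)"
        using False by (auto simp: sum_distrib_left P_def intro!: sum.cong)
      also have "\<dots> = B i * (\<psi> (Suc i) * Z i (Suc i) - \<psi> k * Z i k)"
        using i False Zr[of i] \<psi> pq by (subst telescope_sum_lessThan) auto
      finally show ?thesis using False \<psi>k by simp
    qed (simp add: P_def)
  qed simp
  \<comment> \<open>The mirror image: for fixed \<open>j\<close> it telescopes in \<open>i\<close>,
    \<open>\<phi> 0 = 0\<close> removes the lower end, and a one-letter term for the letter 1
    survives.\<close>
  have T2: "(\<Sum>i<k. \<Sum>j<k. if P i j then A (Suc j) * (\<phi> (Suc i) * Z (Suc i) (Suc j) - \<phi> i * Z i (Suc j)) else 0)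
      = (\<Sum>j<k. if e j then \<phi> j * A (Suc j) * Z j (Suc j) else 0)"
  proof (subst sum.swap, rule sum.cong)
    fix j assume j: "j \<in> {..<k}"
    show "(\<Sum>i<k. if P i j then A (Suc j) * (\<phi> (Suc i) * Z (Suc i) (Suc j) - \<phi> i * Z i (Suc j)) else 0)
        = (if e j then \<phi> j * A (Suc j) * Z j (Suc j) else 0)"
    proof (cases "e j")
      case True
      have "(\<Sum>i<k. if P i j then A (Suc j) * (\<phi> (Suc i) * Z (Suc i) (Suc j) - \<phi> i * Z i (Suc j)) else 0)
        = A (Suc j) * (\<Sum>i<k. if i \<le> j \<and> \<not> e i then \<phi> (Suc i) * Z (Suc i) (Suc j) - \<phi> i * Z i (Suc j) else 0)"
        using True by (auto simp: sum_distrib_left P_def intro!: sum.cong)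
      also have "\<dots> = A (Suc j) * (\<phi> j * Z j (Suc j) - \<phi> 0 * Z 0 (Suc j))"
        using j True Zl[of _ "Suc j"] \<phi> pq
        by (subst telescope_sum_atMost[where H = "\<lambda>i. \<phi> i * Z i (Suc j)"]) auto
      finally show ?thesis using True \<phi>0 by simp
    qed (simp add: P_def)
  qed simp
  \<comment> \<open>The remaining difference \<open>G (Suc i) j - G i (Suc j)\<close> is split at
    \<open>G (Suc i) (Suc j)\<close>; the first half telescopes in \<open>j\<close>, the second
    (\<open>T3b\<close>) in \<open>i\<close>.\<close>
  have T3a: "(\<Sum>i<k. \<Sum>j<k. if P i j then G (Suc i) j - G (Suc i) (Suc j) else 0)
      = (\<Sum>i<k. if \<not> e i then G (Suc i) (Suc i) else 0)"
  proof (rule sum.cong)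
    fix i assume i: "i \<in> {..<k}"
    show "(\<Sum>j<k. if P i j then G (Suc i) j - G (Suc i) (Suc j) else 0)
        = (if \<not> e i then G (Suc i) (Suc i) else 0)"
    proof (cases "e i")
      case False
      have "(\<Sum>j<k. if P i j then G (Suc i) j - G (Suc i) (Suc j) else 0)
        = (\<Sum>j<k. if i \<le> j \<and> e j then G (Suc i) j - G (Suc i) (Suc j) else 0)"
        using False by (auto simp: P_def intro!: sum.cong)
      also have "\<dots> = G (Suc i) (Suc i) - G (Suc i) k"
        using i False Gr[of "Suc i"] by (subst telescope_sum_lessThan) auto
      finally show ?thesis using False \<psi>k by (simp add: G_def)
    qed (simp add: P_def)
  qed simp
  have T3b: "(\<Sum>i<k. \<Sum>j<k. if P i j then G (Suc i) (Suc j) - G i (Suc j) else 0)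
      = (\<Sum>j<k. if e j then G (Suc j) (Suc j) else 0)"
  proof (subst sum.swap, rule sum.cong)
    fix j assume j: "j \<in> {..<k}"
    show "(\<Sum>i<k. if P i j then G (Suc i) (Suc j) - G i (Suc j) else 0)
        = (if e j then G (Suc j) (Suc j) else 0)"
    proof (cases "e j")
      case True
      have "(\<Sum>i<k. if P i j then G (Suc i) (Suc j) - G i (Suc j) else 0)
        = (\<Sum>i<k. if i \<le> j \<and> \<not> e i then G (Suc i) (Suc j) - G i (Suc j) else 0)"
        using True by (auto simp: P_def intro!: sum.cong)
      also have "\<dots> = G j (Suc j) - G 0 (Suc j)"
        using j True Gl[of _ "Suc j"]
        by (subst telescope_sum_atMost[where H = "\<lambda>i. G i (Suc j)"]) auto
      also have "G j (Suc j) = G (Suc j) (Suc j)"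
        using True j by (intro Gl) auto
      finally show ?thesis using True \<phi>0 by (simp add: G_def)
    qed (simp add: P_def)
  qed simp
  \<comment> \<open>Every position carries exactly one letter, so the two sums together run over the
    whole diagonal; its last term is 0 by \<open>\<psi> k = 0\<close>.\<close>
  have diag: "(\<Sum>i<k. if \<not> e i then G (Suc i) (Suc i) else 0) + (\<Sum>j<k. if e j then G (Suc j) (Suc j) else 0)
      = (\<Sum>i=1..<k. G i i)"
  proof -
    have "(\<Sum>i<k. if \<not> e i then G (Suc i) (Suc i) else 0) + (\<Sum>j<k. if e j then G (Suc j) (Suc j) else 0)
        = (\<Sum>i<k. G (Suc i) (Suc i))"
      by (subst sum.distrib[symmetric]) (auto intro!: sum.cong)
    also have "\<dots> = (\<Sum>i=1..<Suc k. G i i)"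
      by (simp only: One_nat_def sum.shift_bounds_Suc_ivl lessThan_atLeast0)
    also have "\<dots> = (\<Sum>i=1..<k. G i i)"
      using k \<psi>k by (simp add: G_def)
    finally show ?thesis .
  qed
  have "(\<Sum>i<k. \<Sum>j<k. if P i j then B i * A (Suc j) * Z' i (Suc j) else 0)
    = (\<Sum>i<k. \<Sum>j<k.
        (if P i j then (B i + \<phi> i) * (A (Suc j) + \<psi> (Suc j)) * Z i (Suc j) else 0)
      + (if P i j then B i * (\<psi> j * Z i j - \<psi> (Suc j) * Z i (Suc j)) else 0)
      + (if P i j then A (Suc j) * (\<phi> (Suc i) * Z (Suc i) (Suc j) - \<phi> i * Z i (Suc j)) else 0)
      + (if P i j then G (Suc i) j - G (Suc i) (Suc j) else 0)
      + (if P i j then G (Suc i) (Suc j) - G i (Suc j) else 0))"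
  proof (intro sum.cong refl)
    fix i j assume ij: "i \<in> {..<k}" "j \<in> {..<k}"
    show "(if P i j then B i * A (Suc j) * Z' i (Suc j) else 0) =
        (if P i j then (B i + \<phi> i) * (A (Suc j) + \<psi> (Suc j)) * Z i (Suc j) else 0)
      + (if P i j then B i * (\<psi> j * Z i j - \<psi> (Suc j) * Z i (Suc j)) else 0)
      + (if P i j then A (Suc j) * (\<phi> (Suc i) * Z (Suc i) (Suc j) - \<phi> i * Z i (Suc j)) else 0)
      + (if P i j then G (Suc i) j - G (Suc i) (Suc j) else 0)
      + (if P i j then G (Suc i) (Suc j) - G i (Suc j) else 0)"
    proof (cases "P i j")
      case True
      \<comment> \<open>For letter 0 at \<open>i\<close> and letter 1 at \<open>j\<close> the
        recurrences express \<open>B\<close> and \<open>A\<close> by \<phi> and \<psi>, which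
        absorbs the divisions by \<open>p\<close> and \<open>q\<close> in the relation for
        \<open>Z'\<close>.\<close>
      have B: "B i = p * \<phi> (Suc i)" and A: "A (Suc j) = q * \<psi> j"
        using True ij \<phi>[of i] \<psi>[of j] pq by (auto simp: P_def)
      have Z: "Z' i (Suc j) = Z i (Suc j) + Z i j / q + Z (Suc i) (Suc j) / p + Z (Suc i) j / (p * q)"
        using True ij less[of i j] by (intro Z') (auto simp: P_def)
      show ?thesis
        unfolding Z A B G_def using True pq by (simp add: field_simps)
    qed simp
  qed
  then show ?thesis
    unfolding sum.distrib T1 T2 T3a T3b P_def[symmetric] using diag by (simp add: G_def)
qed

section \<open>Subwords, and the index sets as ranges of letter positions\<close>

lemma mid_word_Cons:
  assumes "i < j" "j \<le> length w"
  shows "mid_word w (i, j) = w ! i # mid_word w (Suc i, j)"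
proof -
  obtain d where d: "j = Suc (i + d)" using assms(1) less_imp_Suc_add by blast
  have "drop i w = w ! i # drop (Suc i) w" using assms by (intro Cons_nth_drop_Suc[symmetric]) simp
  then show ?thesis by (simp add: mid_word_def d)
qed

lemma mid_word_snoc:
  assumes "i \<le> j" "j < length w"
  shows "mid_word w (i, Suc j) = mid_word w (i, j) @ [w ! j]"
  using assms by (simp add: mid_word_def Suc_diff_le take_Suc_conv_app_nth)

lemma mid_word_self [simp]: "mid_word w (i, i) = []"
  by (simp add: mid_word_def)

lemma length_mid_word: "i \<le> j \<Longrightarrow> j \<le> length w \<Longrightarrow> length (mid_word w (i, j)) = j - i"
  by (simp add: mid_word_def)

text \<open>A pair is indexed by the positions of the first and last letters of its subword, hence
  the shift to \<open>Suc j\<close>. The square with a condition is the form used in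
  \<open>double_telescope\<close>.\<close>

lemma sum_S_adm:
  fixes f :: "nat \<times> nat \<Rightarrow> real"
  shows "sum f (S_adm w) =
    (\<Sum>i<length w. \<Sum>j<length w. if i \<le> j \<and> \<not> w ! i \<and> w ! j then f (i, Suc j) else 0)"
proof -
  let ?T = "{x \<in> {..<length w} \<times> {..<length w}. fst x \<le> snd x \<and> \<not> w ! fst x \<and> w ! snd x}"
  have "S_adm w = (\<lambda>(i, j). (i, Suc j)) ` ?T"
  proof (intro equalityI subsetI)
    fix s assume s: "s \<in> S_adm w"
    obtain i j where ij: "s = (i, j)" by (cases s)
    have le: "i \<le> j" "j \<le> length w" and ne: "mid_word w (i, j) \<noteq> []"
      and hl: "\<not> hd (mid_word w (i, j))" "last (mid_word w (i, j))"
      using s by (auto simp: S_adm_def pairs_def ij)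
    have "i \<noteq> j" using ne by auto
    then obtain j' where j': "j = Suc j'" "i \<le> j'" "j' < length w"
      using le by (cases j) auto
    have "\<not> w ! i" "w ! j'"
      using hl mid_word_Cons[of i j w] mid_word_snoc[of i j' w] j' by simp_all
    then show "s \<in> (\<lambda>(i, j). (i, Suc j)) ` ?T"
      using j' ij by (intro image_eqI[of _ _ "(i, j')"]) auto
  next
    fix s assume "s \<in> (\<lambda>(i, j). (i, Suc j)) ` ?T"
    then obtain i j where ij: "s = (i, Suc j)" "i \<le> j" "j < length w" "\<not> w ! i" "w ! j" by auto
    then have "hd (mid_word w (i, Suc j)) = False" "last (mid_word w (i, Suc j)) = True"
      by (simp add: mid_word_Cons, simp add: mid_word_snoc)
    then show "s \<in> S_adm w"
      using ij by (auto simp: S_adm_def pairs_def mid_word_snoc)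
  qed
  then have "sum f (S_adm w) = (\<Sum>(i, j)\<in>?T. f (i, Suc j))"
    by (simp add: sum.reindex inj_on_def case_prod_unfold)
  also have "\<dots> = (\<Sum>(i, j)\<in>{..<length w} \<times> {..<length w}. if i \<le> j \<and> \<not> w ! i \<and> w ! j then f (i, Suc j) else 0)"
    by (simp add: sum.inter_filter case_prod_unfold)
  also have "\<dots> = (\<Sum>i<length w. \<Sum>j<length w. if i \<le> j \<and> \<not> w ! i \<and> w ! j then f (i, Suc j) else 0)"
    by (rule sum.cartesian_product[symmetric])
  finally show ?thesis .
qed

lemma pairs_mid_word_singleton:
  "{s \<in> pairs w. mid_word w s = [e]} = (\<lambda>i. (i, Suc i)) ` {i \<in> {..<length w}. w ! i = e}"
proof (intro equalityI subsetI)
  fix s assume s: "s \<in> {s \<in> pairs w. mid_word w s = [e]}"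
  obtain i j where ij: "s = (i, j)" by (cases s)
  have le: "i \<le> j" "j \<le> length w" and mw: "mid_word w (i, j) = [e]"
    using s by (auto simp: pairs_def ij)
  have "j = Suc i" using length_mid_word[OF le] mw by simp
  then show "s \<in> (\<lambda>i. (i, Suc i)) ` {i \<in> {..<length w}. w ! i = e}"
    using mid_word_Cons[of i j w] mw le ij by auto
qed (auto simp: pairs_def mid_word_Cons)

lemma sum_mid_word_singleton:
  fixes f :: "nat \<times> nat \<Rightarrow> real"
  shows "sum f {s \<in> pairs w. mid_word w s = [e]} = (\<Sum>i<length w. if w ! i = e then f (i, Suc i) else 0)"
proof -
  have "sum f {s \<in> pairs w. mid_word w s = [e]} = (\<Sum>i\<in>{i \<in> {..<length w}. w ! i = e}. f (i, Suc i))"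
    unfolding pairs_mid_word_singleton by (subst sum.reindex) (auto simp: inj_on_def)
  also have "\<dots> = (\<Sum>i<length w. if w ! i = e then f (i, Suc i) else 0)"
    by (rule sum.inter_filter) simp
  finally show ?thesis .
qed

lemma sum_S_empty:
  fixes f :: "nat \<times> nat \<Rightarrow> real"
  shows "sum f (S_empty w) = (\<Sum>i=1..<length w. f (i, i))"
proof -
  have "S_empty w = (\<lambda>i. (i, i)) ` {1..<length w}" by (auto simp: S_empty_def)
  then show ?thesis by (simp add: sum.reindex inj_on_def)
qed

text \<open>An instance of \<open>double_telescope\<close>, with old parameters
  \<open>m + M\<close>, \<open>n + M\<close> and new ones larger by 1.\<close>

lemma zeta_int_double_tail_step:
  fixes w :: bword and m n M :: nat
  assumes w: "w \<noteq> []" "admissible w"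
  defines "F \<equiv> \<lambda>M. \<Sum>s\<in>S_adm w. zeta_trunc m (m + M) (comp_b w s) * zeta_trunc n (n + M) (comp_a w s)
                     * zeta_int (mid_word w s) (m + M) (n + M)"
  shows "F M = F (Suc M)
    + (\<Sum>s\<in>S_zero w. zeta_trunc m (m + M) (comp_b w s) * phi n (n + Suc M) (comp_a w s)
                     * zeta_int [False] (m + Suc M) (n + Suc M))
    + (\<Sum>s\<in>S_one w. phi m (m + Suc M) (comp_b w s) * zeta_trunc n (n + M) (comp_a w s)
                     * zeta_int [True] (m + Suc M) (n + Suc M))
    + (\<Sum>s\<in>S_empty w. phi m (m + Suc M) (comp_b w s) * phi n (n + Suc M) (comp_a w s)
                     * zeta_int [] (m + Suc M) (n + Suc M))"
proof -
  define k where "k = length w"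
  define p q where "p = m + M" and "q = n + M"
  define wa where "wa j = drop j w" for j
  define wb where "wb i = map Not (rev (take i w))" for i
  define A where "A j = zeta_trunc n q (comp_of_word (wa j))" for j
  define B where "B i = zeta_trunc m p (comp_of_word (wb i))" for i
  \<comment> \<open>At \<open>j = k\<close> the composition is empty and \<open>phi\<close> has no
    meaning. The value 0 fits there, since the truncated sum of the empty composition is constantly
    1; the same holds for \<phi> at 0.\<close>
  define \<psi> where "\<psi> j = (if j = k then 0 else phi n (Suc q) (comp_of_word (wa j)))" for j
  define \<phi> where "\<phi> i = (if i = 0 then 0 else phi m (Suc p) (comp_of_word (wb i)))" for i
  define Z where "Z i j = zeta_int (mid_word w (i, j)) (Suc p) (Suc q)" for i j
  define Z' where "Z' i j = zeta_int (mid_word w (i, j)) p q" for i j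
  have k0: "0 < k" using w by (simp add: k_def)
  have first: "\<not> w ! 0" and last: "w ! (k - 1)"
    using w by (auto simp: admissible_def hd_conv_nth last_conv_nth k_def)
  have wa_last: "wa j = [] \<or> List.last (wa j)" for j
    using w by (cases "j < length w") (auto simp: wa_def admissible_def)
  have wb_last: "wb i = [] \<or> List.last (wb i)" for i
    using w by (cases i; cases w) (auto simp: wb_def admissible_def last_map last_rev)
  have wa_Cons: "wa j = w ! j # wa (Suc j)" if "j < k" for j
    using that by (simp add: wa_def k_def Cons_nth_drop_Suc)
  have wb_Suc: "wb (Suc i) = (\<not> w ! i) # wb i" if "i < k" for i
    using that by (simp add: wb_def k_def take_Suc_conv_app_nth)
  have wa_ne: "wa j \<noteq> [] \<longleftrightarrow> j < k" for j by (simp add: wa_def k_def not_le)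
  have wb_ne: "wb i \<noteq> [] \<longleftrightarrow> 0 < i" for i using w by (simp add: wb_def)
  have A_Suc: "zeta_trunc n (Suc q) (comp_of_word (wa j)) = A j + \<psi> j" if "j \<le> k" for j
    using that wa_ne[of j] zeta_trunc_Suc[of n q "comp_of_word (wa j)"] comp_of_word_eq_Nil_iff[OF wa_last[of j]]
    by (cases "j = k") (auto simp: A_def \<psi>_def q_def)
  have B_Suc: "zeta_trunc m (Suc p) (comp_of_word (wb i)) = B i + \<phi> i" for i
    using wb_ne[of i] zeta_trunc_Suc[of m p "comp_of_word (wb i)"] comp_of_word_eq_Nil_iff[OF wb_last[of i]]
    by (cases "i = 0") (auto simp: B_def \<phi>_def p_def)
  have \<psi>_rec: "\<psi> j = (if w ! j then A (Suc j) else \<psi> (Suc j)) / real (Suc q)" if "j < k" for j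
  proof -
    \<comment> \<open>The last letter of \<open>w\<close> is 1, so a letter 0 is never followed by
      the empty suffix, where \<psi> has its default value.\<close>
    have "w ! j \<or> Suc j \<noteq> k" using last by (cases "Suc j = k") auto
    then show ?thesis
      using that phi_comp_of_word_Cons[OF wa_last[of "Suc j"], of "w ! j" n q] wa_ne[of "Suc j"]
      by (auto simp: \<psi>_def A_def wa_Cons[OF that])
  qed
  have \<phi>_rec: "\<phi> (Suc i) = (if w ! i then \<phi> i else B i) / real (Suc p)" if "i < k" for i
  proof -
    \<comment> \<open>In the dual word the letter is negated, so here the letter 0 opens a new
      entry, and the excluded case is a 1 at the first position.\<close>
    have "\<not> w ! i \<or> i \<noteq> 0" using first by (cases "i = 0") auto
    then show ?thesis
      using that phi_comp_of_word_Cons[OF wb_last[of i], of "\<not> w ! i" m p] wb_ne[of i]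
      by (auto simp: \<phi>_def B_def wb_Suc[OF that])
  qed
  have Zl: "Z i j = Z (Suc i) j / real (Suc p)" if "i < j" "j \<le> k" "w ! i" for i j
    using that mid_word_Cons[of i j w] by (simp add: Z_def k_def zeta_int_Cons_True del: of_nat_Suc)
  have Zr: "Z i (Suc j) = Z i j / real (Suc q)" if "i \<le> j" "j < k" "\<not> w ! j" for i j
    using that mid_word_snoc[of i j w] by (simp add: Z_def k_def zeta_int_snoc_False del: of_nat_Suc)
  have ZZ: "Z' i (Suc j) = Z i (Suc j) + Z i j / real (Suc q) + Z (Suc i) (Suc j) / real (Suc p)
      + Z (Suc i) j / (real (Suc p) * real (Suc q))" if "i < j" "j < k" "\<not> w ! i" "w ! j" for i j
  proof -
    define v where "v = mid_word w (Suc i, j)"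
    have "mid_word w (i, Suc j) = False # v @ [True]" "mid_word w (i, j) = False # v"
      "mid_word w (Suc i, Suc j) = v @ [True]"
      using that mid_word_Cons[of i j w] mid_word_Cons[of i "Suc j" w] mid_word_snoc[of "Suc i" j w]
      by (simp_all add: k_def v_def)
    then show ?thesis
      using zeta_int_admissible_step[of v p q] by (simp add: Z_def Z'_def v_def del: of_nat_Suc)
  qed
  have 1: "F M = (\<Sum>i<k. \<Sum>j<k. if i \<le> j \<and> \<not> w ! i \<and> w ! j then B i * A (Suc j) * Z' i (Suc j) else 0)"
    unfolding F_def sum_S_adm k_def[symmetric]
    by (intro sum.cong refl if_cong)
       (simp add: comp_a_def comp_b_def A_def B_def Z'_def wa_def wb_def p_def q_def)
  have 2: "F (Suc M) = (\<Sum>i<k. \<Sum>j<k. if i \<le> j \<and> \<not> w ! i \<and> w ! j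
      then (B i + \<phi> i) * (A (Suc j) + \<psi> (Suc j)) * Z i (Suc j) else 0)"
    unfolding F_def sum_S_adm k_def[symmetric]
  proof (intro sum.cong refl if_cong)
    fix i j assume "i \<in> {..<k}" "j \<in> {..<k}"
    then show "zeta_trunc m (m + Suc M) (comp_b w (i, Suc j)) * zeta_trunc n (n + Suc M) (comp_a w (i, Suc j))
        * zeta_int (mid_word w (i, Suc j)) (m + Suc M) (n + Suc M)
      = (B i + \<phi> i) * (A (Suc j) + \<psi> (Suc j)) * Z i (Suc j)"
      using A_Suc[of "Suc j"] B_Suc[of i]
      by (simp add: comp_a_def comp_b_def Z_def wa_def wb_def p_def q_def)
  qed
  have 3: "(\<Sum>s\<in>S_zero w. zeta_trunc m (m + M) (comp_b w s) * phi n (n + Suc M) (comp_a w s)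
                     * zeta_int [False] (m + Suc M) (n + Suc M))
      = (\<Sum>i<k. if \<not> w ! i then B i * \<psi> (Suc i) * Z i (Suc i) else 0)"
    unfolding S_zero_def sum_mid_word_singleton k_def[symmetric]
  proof (intro sum.cong refl)
    fix i assume "i \<in> {..<k}"
    \<comment> \<open>For a letter 0, \<open>Suc i\<close> is therefore below \<open>k\<close>, so
      \<psi> agrees with \<open>phi\<close> there.\<close>
    moreover have "Suc i = k \<Longrightarrow> w ! i" using last by auto
    ultimately show "(if w ! i = False then zeta_trunc m (m + M) (comp_b w (i, Suc i)) * phi n (n + Suc M) (comp_a w (i, Suc i))
                     * zeta_int [False] (m + Suc M) (n + Suc M) else 0)
        = (if \<not> w ! i then B i * \<psi> (Suc i) * Z i (Suc i) else 0)"
      using mid_word_Cons[of i "Suc i" w]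
      by (auto simp: comp_a_def comp_b_def Z_def B_def \<psi>_def wa_def wb_def p_def q_def k_def)
  qed
  have 4: "(\<Sum>s\<in>S_one w. phi m (m + Suc M) (comp_b w s) * zeta_trunc n (n + M) (comp_a w s)
                     * zeta_int [True] (m + Suc M) (n + Suc M))
      = (\<Sum>i<k. if w ! i then \<phi> i * A (Suc i) * Z i (Suc i) else 0)"
    unfolding S_one_def sum_mid_word_singleton k_def[symmetric]
  proof (intro sum.cong refl)
    fix i assume "i \<in> {..<k}"
    moreover have "i = 0 \<Longrightarrow> \<not> w ! i" using first by auto
    ultimately show "(if w ! i = True then phi m (m + Suc M) (comp_b w (i, Suc i)) * zeta_trunc n (n + M) (comp_a w (i, Suc i))
                     * zeta_int [True] (m + Suc M) (n + Suc M) else 0)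
        = (if w ! i then \<phi> i * A (Suc i) * Z i (Suc i) else 0)"
      using mid_word_Cons[of i "Suc i" w]
      by (auto simp: comp_a_def comp_b_def Z_def A_def \<phi>_def wa_def wb_def p_def q_def k_def)
  qed
  have 5: "(\<Sum>s\<in>S_empty w. phi m (m + Suc M) (comp_b w s) * phi n (n + Suc M) (comp_a w s)
                     * zeta_int [] (m + Suc M) (n + Suc M))
      = (\<Sum>i=1..<k. \<phi> i * \<psi> i * Z i i)"
    unfolding sum_S_empty k_def[symmetric]
    by (intro sum.cong refl)
       (auto simp: comp_a_def comp_b_def Z_def \<phi>_def \<psi>_def wa_def wb_def p_def q_def)
  show ?thesis
    unfolding 1 2 3 4 5
    by (rule double_telescope[where p = "real (Suc p)" and q = "real (Suc q)"])
       (use k0 first last \<phi>_rec \<psi>_rec Zl Zr ZZ in \<open>auto simp: \<phi>_def \<psi>_def simp del: of_nat_Suc\<close>)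
qed

theorem theorem7:
  fixes w :: bword and m n N :: nat
  assumes "w \<noteq> []" and "admissible w" and "N \<ge> 1"
  shows "zeta_int w m n =
      (\<Sum>s\<in>S_adm w. zeta_trunc m (m + N) (comp_b w s) * zeta_trunc n (n + N) (comp_a w s)
                     * zeta_int (mid_word w s) (m + N) (n + N))
    + (\<Sum>M=1..N. \<Sum>s\<in>S_zero w. zeta_trunc m (m + M - 1) (comp_b w s) * phi n (n + M) (comp_a w s)
                     * zeta_int [False] (m + M) (n + M))
    + (\<Sum>M=1..N. \<Sum>s\<in>S_one w. phi m (m + M) (comp_b w s) * zeta_trunc n (n + M - 1) (comp_a w s)
                     * zeta_int [True] (m + M) (n + M))
    + (\<Sum>M=1..N. \<Sum>s\<in>S_empty w. phi m (m + M) (comp_b w s) * phi n (n + M) (comp_a w s)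
                     * zeta_int [] (m + M) (n + M))"
proof -
  define F where "F M = (\<Sum>s\<in>S_adm w. zeta_trunc m (m + M) (comp_b w s) * zeta_trunc n (n + M) (comp_a w s)
                     * zeta_int (mid_word w s) (m + M) (n + M))" for M
  \<comment> \<open>At \<open>M = 0\<close> the truncated sums have empty ranges and vanish unless
    both compositions are empty, which leaves only the pair whose subword is
    \<open>w\<close>.\<close>
  have "F 0 = zeta_int w m n"
  proof -
    have top: "(0, length w) \<in> S_adm w"
      using assms by (auto simp: S_adm_def pairs_def mid_word_def admissible_def)
    have zero: "zeta_trunc m m (comp_b w s) * zeta_trunc n n (comp_a w s) = 0"
      if "s \<in> S_adm w" "s \<noteq> (0, length w)" for s
    proof -
      obtain i j where ij: "s = (i, j)" by (cases s)
      have "0 < i \<or> j < length w" using that ij by (auto simp: S_adm_def pairs_def)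
      then show ?thesis
      proof
        assume "0 < i"
        then have "map Not (rev (take i w)) \<noteq> []" "last (map Not (rev (take i w)))"
          using assms by (auto simp: last_map last_rev admissible_def hd_conv_nth)
        then have "comp_b w s \<noteq> []"
          by (auto simp: comp_b_def ij comp_of_word_eq_Nil_iff)
        then show ?thesis by (simp add: zeta_trunc_self)
      next
        assume "j < length w"
        then have "drop j w \<noteq> []" "last (drop j w)"
          using assms by (auto simp: admissible_def)
        then have "comp_a w s \<noteq> []"
          by (auto simp: comp_a_def ij comp_of_word_eq_Nil_iff)
        then show ?thesis by (simp add: zeta_trunc_self)
      qed
    qed
    have "finite (S_adm w)"
      by (rule finite_subset[of _ "{..length w} \<times> {..length w}"]) (auto simp: S_adm_def pairs_def)
    then have "F 0 = (\<Sum>s\<in>{(0, length w)}. zeta_trunc m (m + 0) (comp_b w s) * zeta_trunc n (n + 0) (comp_a w s)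
                     * zeta_int (mid_word w s) (m + 0) (n + 0))"
      unfolding F_def using top zero by (intro sum.mono_neutral_right) auto
    then show ?thesis by (simp add: comp_a_def comp_b_def mid_word_def)
  qed
  \<comment> \<open>Adding up the steps: the new index \<open>M = Suc N\<close> satisfies
    \<open>m + M - 1 = m + N\<close>, the bound that occurs in the step from \<open>N\<close> to
    \<open>Suc N\<close>.\<close>
  moreover have "F 0 = F N
    + (\<Sum>M=1..N. \<Sum>s\<in>S_zero w. zeta_trunc m (m + M - 1) (comp_b w s) * phi n (n + M) (comp_a w s)
                     * zeta_int [False] (m + M) (n + M))
    + (\<Sum>M=1..N. \<Sum>s\<in>S_one w. phi m (m + M) (comp_b w s) * zeta_trunc n (n + M - 1) (comp_a w s)
                     * zeta_int [True] (m + M) (n + M))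
    + (\<Sum>M=1..N. \<Sum>s\<in>S_empty w. phi m (m + M) (comp_b w s) * phi n (n + M) (comp_a w s)
                     * zeta_int [] (m + M) (n + M))" for N
  proof (induction N)
    case (Suc N)
    then show ?case
      using zeta_int_double_tail_step[OF assms(1,2), where m = m and n = n and M = N] by (simp add: F_def)
  qed simp
  ultimately show ?thesis by (simp add: F_def)
qed

end
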